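(* Let $n\ge2$, let $f$ be a radial function on $\mathbb R^n$, and let $w(x)=w_0(|x|)$ be a radial weight in $A_1(\mathbb R^n)$. Then $$\|\mathcal K f\|^{\ast}_{L^{n,\infty}(\mathbb R^n,w)}\le\frac{2n}{n-1}\,\big[2\,(w)_{A_1(\mathbb R^n)}\big]^{1/n}\,\|f\|^{\ast}_{L^{n,1}(\mathbb R^n,w)}.$$
   Context: The universal maximal operator on $\mathbb R^n$ is $$\mathcal K f(x)=\sup_{u\in\mathbb S^{n-1}}\ \sup_{a\le0\le b,\ a<b}\ \frac1{b-a}\int_a^b|f(x+su)|\,ds.$$ A weight on $\mathbb R^n$ is an a.e. nonnegative, locally integrable function; $w(E)=\int_E w$ for measurable $E$. A weight $w$ is in $A_1(\mathbb R^n)$ if there is $C>0$ with $Mw\le C\,w$ a.e., where $M$ is the centered Hardy–Littlewood maximal operator over Euclidean balls. For a radial weight $w(x)=w_0(|x|)$ this is equivalent to finiteness of $(w)_{A_1(\mathbb R^n)}$, defined as the smallest $C>0$ such that $$\frac{\int_I w_0(t)t^{n-1}\,dt}{\int_I t^{n-1}\,dt}\le C\operatorname*{ess\,inf}_{t\in I}w_0(t)$$ for all bounded intervals $I\subset[0,\infty)$ of positive length. The weighted Lorentz quasi-norms are $$\|g\|^{\ast}_{L^{n,\infty}(\mathbb R^n,w)}=\sup_{\lambda>0}\lambda\,w(\{|g|>\lambda\})^{1/n},\qquad \|g\|^{\ast}_{L^{n,1}(\mathbb R^n,w)}=\frac1n\int_0^\infty t^{1/n}g^{\ast}(t)\,\frac{dt}{t}=\int_0^\infty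 w(\{|g|>\lambda\})^{1/n}\,d\lambda,$$ where $g^{\ast}$ is the decreasing rearrangement of $g$ with respect to the measure $w(x)\,dx$; in particular $\|\chi_E\|^{\ast}_{L^{n,1}(\mathbb R^n,w)}=w(E)^{1/n}$. *)

theory Defs
  imports "HOL-Analysis.Analysis"
begin

text \<open>
  All averages, maximal functions and quasi-norms take values in \<^typ>\<open>ennreal\<close>, and all measure
  theory is with respect to Lebesgue measure. The Lorentz quasi-norms take the function \<open>g = \<bar>g\<bar>\<close>
  with values in \<open>[0, \<infinity>]\<close>, so that they apply both to \<open>\<K> f\<close>, which may be infinite, and to
  \<open>\<lambda>x. ennreal (norm (f x))\<close>.
\<close>

text \<open>The power \<open>x^a\<close> on \<open>[0, \<infinity>]\<close> for an exponent \<open>a > 0\<close>, with \<open>\<infinity>^a = \<infinity>\<close>.\<close>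

definition ennpowr :: "ennreal \<Rightarrow> real \<Rightarrow> ennreal" where
  "ennpowr x a = (if x = top then top else ennreal (enn2real x powr a))"

definition radial :: "('a::real_normed_vector \<Rightarrow> 'b) \<Rightarrow> bool" where
  "radial f \<longleftrightarrow> (\<exists>f0 :: real \<Rightarrow> 'b. \<forall>x. f x = f0 (norm x))"

definition universal_maximal ::
  "('a::euclidean_space \<Rightarrow> 'b::real_normed_vector) \<Rightarrow> 'a \<Rightarrow> ennreal" where
  "universal_maximal f x =
     (SUP u\<in>sphere 0 1. SUP (a, b)\<in>{(a::real, b). a \<le> 0 \<and> 0 \<le> b \<and> a < b}.
        (\<integral>\<^sup>+s\<in>{a..b}. ennreal (norm (f (x + s *\<^sub>R u))) \<partial>lebesgue) / ennreal (b - a))"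


subsection \<open>Weights\<close>

text \<open>Local integrability includes measurability.\<close>

definition weight :: "('a::euclidean_space \<Rightarrow> real) \<Rightarrow> bool" where
  "weight w \<longleftrightarrow>
     (AE x in lebesgue. 0 \<le> w x) \<and> (\<forall>K. compact K \<longrightarrow> set_integrable lebesgue K w)"

text \<open>\<open>w(E) = \<integral>\<^sub>E w\<close>; negative values of \<open>w\<close>, which occur on a null set only, are cut off.
  For non-measurable \<open>E\<close> this is a lower integral; the level sets \<open>{\<K> f > \<lambda>}\<close> of radial measurable \<open>f\<close>
  are open, so this case does not arise.\<close>

definition wmeasure :: "('a::euclidean_space \<Rightarrow> real) \<Rightarrow> 'a set \<Rightarrow> ennreal" where
  "wmeasure w E = (\<integral>\<^sup>+x\<in>E. ennreal (w x) \<partial>lebesgue)"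

definition HL_maximal :: "('a::euclidean_space \<Rightarrow> real) \<Rightarrow> 'a \<Rightarrow> ennreal" where
  "HL_maximal w x =
     (SUP r\<in>{0<..}. (\<integral>\<^sup>+y\<in>ball x r. ennreal \<bar>w y\<bar> \<partial>lebesgue) / emeasure lebesgue (ball x r))"

definition A1_weight :: "('a::euclidean_space \<Rightarrow> real) \<Rightarrow> bool" where
  "A1_weight w \<longleftrightarrow>
     weight w \<and> (\<exists>C>0. AE x in lebesgue. HL_maximal w x \<le> ennreal (C * w x))"

definition ess_inf_on :: "real set \<Rightarrow> (real \<Rightarrow> ennreal) \<Rightarrow> ennreal" where
  "ess_inf_on I h = Sup {c. AE t in lebesgue. t \<in> I \<longrightarrow> c \<le> h t}"

text \<open>
  The constant \<open>(w)\<close> of the radial weight \<open>w(x) = w\<^sub>0(|x|)\<close> in dimension \<open>n\<close>. It is \<open>\<infinity>\<close> if no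
  admissible \<open>C\<close> exists. If \<open>w\<close> is not a.e. zero and some \<open>C\<close> is admissible, then the infimum is
  attained; for \<open>w = 0\<close> a.e. every \<open>C > 0\<close> is admissible and the value is \<open>0\<close>.
\<close>

definition radial_A1_const :: "nat \<Rightarrow> (real \<Rightarrow> real) \<Rightarrow> ennreal" where
  "radial_A1_const n w0 =
     Inf {ennreal C | C. 0 < C \<and>
       (\<forall>I. is_interval I \<and> bounded I \<and> I \<subseteq> {0..} \<and> 0 < emeasure lebesgue I \<longrightarrow>
          (\<integral>\<^sup>+t\<in>I. ennreal (w0 t * t ^ (n - 1)) \<partial>lebesgue) / (\<integral>\<^sup>+t\<in>I. ennreal (t ^ (n - 1)) \<partial>lebesgue)
            \<le> ennreal C * ess_inf_on I (\<lambda>t. ennreal (w0 t)))}"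


subsection \<open>Weighted Lorentz quasi-norms\<close>

definition lorentz_weak ::
  "real \<Rightarrow> ('a::euclidean_space \<Rightarrow> real) \<Rightarrow> ('a \<Rightarrow> ennreal) \<Rightarrow> ennreal" where
  "lorentz_weak p w g =
     (SUP l\<in>{0<..}. ennreal l * ennpowr (wmeasure w {x. g x > ennreal l}) (1 / p))"

definition decreasing_rearrangement ::
  "('a::euclidean_space \<Rightarrow> real) \<Rightarrow> ('a \<Rightarrow> ennreal) \<Rightarrow> real \<Rightarrow> ennreal" where
  "decreasing_rearrangement w g t =
     Inf {ennreal l | l. 0 \<le> l \<and> wmeasure w {x. g x > ennreal l} \<le> ennreal t}"

text \<open>Normalised by \<open>1/p\<close>, so that the quasi-norm of the indicator of \<open>E\<close> is \<open>w(E)^(1/p)\<close>.\<close>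

definition lorentz_1 ::
  "real \<Rightarrow> ('a::euclidean_space \<Rightarrow> real) \<Rightarrow> ('a \<Rightarrow> ennreal) \<Rightarrow> ennreal" where
  "lorentz_1 p w g =
     ennreal (1 / p) *
     (\<integral>\<^sup>+t\<in>{0<..}. ennreal (t powr (1 / p)) * decreasing_rearrangement w g t / ennreal t \<partial>lebesgue)"

end

theory Submission
  imports Defs
begin

text \<open>
  Let \<open>g = |f|\<close> and let \<open>\<mu>\<close> be the measure of radii, the image of \<open>w(x) dx\<close> under the norm. The
  argument turns the \<open>n\<close>-dimensional Kakeya-type maximal operator into a one-dimensional one with
  respect to \<open>\<mu>\<close>.

  A segment on a line at distance \<open>h\<close> from the origin is, after folding at the foot of the
  perpendicular, an interval \<open>[\<alpha>, \<beta>]\<close> of positions \<open>s \<ge> 0\<close>; folding costs a factor \<open>2\<close>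
  (\<open>line_average_reduction\<close>). The radii \<open>sqrt (h\<^sup>2 + s\<^sup>2)\<close> fill an interval \<open>I\<close>, on which the Lebesgue
  measure of \<open>\<real>^n\<close> is \<open>t^(n - 1) dt\<close> up to a constant. In the variable \<open>s\<close> this density is
  increasing and grows at most like a power \<open>n - 1\<close> under dilation from the left endpoint. So a radial
  set that takes up the fraction \<open>\<theta>\<close> of the segment takes up at least the fraction \<open>\<theta>^n\<close> of the
  shell (\<open>line_fraction_le_shell_fraction\<close>), and the \<open>A\<^sub>1\<close> condition replaces Lebesgue measure by
  \<open>\<mu>\<close>: \<open>\<theta>^n \<mu>(I) \<le> C \<mu>(E \<inter> I)\<close>. Applied to all level sets \<open>E l = {g > l}\<close> and integrated over \<open>l\<close>, this
  shows that every point with \<open>\<K> f(x) > \<lambda>\<close> has its norm in an interval \<open>I\<close> with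
  \<open>\<lambda> \<mu>(I)^(1/n) \<le> 2 C^(1/n) \<integral> \<mu>(E l \<inter> I)^(1/n) dl\<close> (\<open>average_le_shell_averages\<close>,
  \<open>weak_type_interval_of_average\<close>).

  These intervals are selected with overlap at most two, and the bounds are summed using
  Hoelder's inequality at each level \<open>l\<close> (\<open>weak_type_interval_family\<close>). The result is
  \<open>\<lambda> \<mu>({\<K> f > \<lambda>})^(1/n) \<le> 2 (2C)^(1/n) \<integral> \<mu>(E l)^(1/n) dl\<close>, and the integral is at most the
  Lorentz quasi-norm (\<open>nn_integral_ennpowr_distribution_le_lorentz_1\<close>).

  Two points need care. Profiles of measurable radial functions are only Lebesgue measurable; they
  are replaced by Borel functions, which changes no average along any line (\<open>radial_borel_profile\<close>,
  \<open>AE_along_line\<close>). And \<open>(w)\<close> may be \<open>0\<close> or \<open>\<infinity>\<close> as far as the definitions show; these cases are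
  settled by the dichotomy that an \<open>A\<^sub>1\<close> weight is zero or positive almost everywhere
  (\<open>A1_weight_zero_or_positive\<close>).
\<close>

section \<open>Powers on the extended half-line and Hoelder's inequality for sums\<close>

lemma ennpowr_ennreal: "0 \<le> x \<Longrightarrow> ennpowr (ennreal x) a = ennreal (x powr a)"
  by (simp add: ennpowr_def)

lemma ennpowr_0 [simp]: "ennpowr 0 a = 0"
  by (simp add: ennpowr_def)

lemma ennpowr_top [simp]: "ennpowr top a = top"
  by (simp add: ennpowr_def)

lemma ennpowr_mono:
  assumes "x \<le> y" "0 \<le> a"
  shows "ennpowr x a \<le> ennpowr y a"
proof (cases "y = top")
  case False
  with assms(1) have "x \<noteq> top" by (auto simp: top_unique)
  with False assms show ?thesis
    by (auto simp: ennpowr_def less_top intro!: ennreal_leI powr_mono2 enn2real_mono)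
qed simp

lemma ennpowr_mult:
  assumes "0 \<le> x" "0 < a"
  shows "ennpowr (ennreal x * y) a = ennreal (x powr a) * ennpowr y a"
proof (cases "y = top \<or> x = 0")
  case True
  then show ?thesis using assms by (auto simp: ennreal_mult_top ennpowr_def)
next
  case False
  then obtain r where r: "y = ennreal r" "0 \<le> r" by (cases y) auto
  then show ?thesis using assms
    by (simp add: ennpowr_ennreal ennreal_mult' [symmetric] powr_mult)
qed

text \<open>
  On \<open>[0, \<infinity>]\<close> the maps \<open>x \<mapsto> x^a\<close> and \<open>x \<mapsto> x^(1/a)\<close> are inverse to each other, so that bounds on
  powers can be turned into bounds on the measures themselves and passed to a supremum.
\<close>

lemma ennpowr_powr:
  assumes "0 < a"
  shows "ennpowr (ennpowr x a) (1 / a) = x"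
  using assms by (cases x) (auto simp: ennpowr_ennreal powr_powr ennpowr_def)

lemma ennpowr_le_iff:
  assumes "0 < a"
  shows "ennpowr x a \<le> y \<longleftrightarrow> x \<le> ennpowr y (1 / a)"
  using ennpowr_powr[OF assms, of x] ennpowr_powr[of "1/a" y] assms
  by (metis divide_divide_eq_right div_by_1 ennpowr_mono less_eq_real_def mult_1 zero_less_divide_1_iff)

lemma ennreal_mult_le_iff_le_divide:
  fixes a z y :: ennreal
  assumes "a \<noteq> 0" "a \<noteq> top"
  shows "a * z \<le> y \<longleftrightarrow> z \<le> y / a"
proof -
  have "y = a * (y / a)"
    using assms by (simp add: ennreal_times_divide mult.commute[of a] mult_divide_eq_ennreal)
  then show ?thesis
    using assms by (metis ennreal_mult_le_mult_iff)
qed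

text \<open>
  After normalising both sums to \<open>1\<close>, each summand is bounded by Young's inequality.
\<close>

lemma Holder_sum_powr:
  fixes x y :: "'i \<Rightarrow> real"
  assumes "finite A" and x: "\<And>i. i \<in> A \<Longrightarrow> 0 \<le> x i" and y: "\<And>i. i \<in> A \<Longrightarrow> 0 \<le> y i"
    and \<theta>: "0 < \<theta>" "\<theta> < 1"
  shows "(\<Sum>i\<in>A. x i powr (1 - \<theta>) * y i powr \<theta>) \<le> sum x A powr (1 - \<theta>) * sum y A powr \<theta>"
proof (cases "sum x A = 0 \<or> sum y A = 0")
  case True
  then have "(\<forall>i\<in>A. x i = 0) \<or> (\<forall>i\<in>A. y i = 0)"
    using sum_nonneg_eq_0_iff[OF \<open>finite A\<close>] x y by metis
  then have "(\<Sum>i\<in>A. x i powr (1 - \<theta>) * y i powr \<theta>) = 0"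
    by (intro sum.neutral) auto
  then show ?thesis by simp
next
  case False
  define X Y where "X = sum x A" and "Y = sum y A"
  have "0 \<le> X" "0 \<le> Y" unfolding X_def Y_def using x y by (auto intro: sum_nonneg)
  with False have XY: "0 < X" "0 < Y" unfolding X_def Y_def by auto
  have "x i powr (1 - \<theta>) * y i powr \<theta>
      \<le> X powr (1 - \<theta>) * Y powr \<theta> * ((1 - \<theta>) * (x i / X) + \<theta> * (y i / Y))" if i: "i \<in> A" for i
  proof (cases "x i = 0 \<or> y i = 0")
    case True
    then show ?thesis using x[OF i] y[OF i] XY \<theta> by (auto intro!: mult_nonneg_nonneg)
  next
    case False
    with x[OF i] y[OF i] have p: "0 < x i / X" "0 < y i / Y" using XY by auto
    have "x i powr (1 - \<theta>) * y i powr \<theta>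
        = X powr (1 - \<theta>) * Y powr \<theta> * ((x i / X) powr (1 - \<theta>) * (y i / Y) powr \<theta>)"
      using XY by (simp add: powr_divide)
    also have "\<dots> \<le> X powr (1 - \<theta>) * Y powr \<theta> * ((1 - \<theta>) * (x i / X) + \<theta> * (y i / Y))"
      using p \<theta> by (intro mult_left_mono Youngs_inequality_0) auto
    finally show ?thesis .
  qed
  then have "(\<Sum>i\<in>A. x i powr (1 - \<theta>) * y i powr \<theta>)
      \<le> (\<Sum>i\<in>A. X powr (1 - \<theta>) * Y powr \<theta> * ((1 - \<theta>) * (x i / X) + \<theta> * (y i / Y)))"
    by (rule sum_mono)
  also have "\<dots> = X powr (1 - \<theta>) * Y powr \<theta> * ((1 - \<theta>) * (sum x A / X) + \<theta> * (sum y A / Y))"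
    by (simp only: sum_distrib_left[symmetric] sum.distrib sum_divide_distrib[symmetric])
  also have "\<dots> = X powr (1 - \<theta>) * Y powr \<theta>"
    using XY by (simp add: X_def Y_def)
  finally show ?thesis by (simp add: X_def Y_def)
qed

section \<open>Covering by intervals\<close>

text \<open>
  If three intervals share a point, the one reaching furthest to the left and the one reaching
  furthest to the right cover the third. Discarding redundant intervals one at a time therefore
  ends with a family in which no point is covered more than twice. This is the source of the
  factor \<open>2\<close> inside the power \<open>[2 (w)]^(1/n)\<close>.
\<close>

lemma finite_interval_cover_overlap_2:
  fixes F :: "real set set"
  assumes "finite F" and "\<And>J. J \<in> F \<Longrightarrow> \<exists>a b. J = {a<..<b}"
  shows "\<exists>F'\<subseteq>F. \<Union>F' = \<Union>F \<and> (\<forall>x. card {J\<in>F'. x \<in> J} \<le> 2)"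
  using assms
proof (induction F rule: finite_psubset_induct)
  case (psubset F)
  show ?case
  proof (cases "\<forall>x. card {J\<in>F. x \<in> J} \<le> 2")
    case True
    then show ?thesis by blast
  next
    case False
    then obtain x where x: "2 < card {J\<in>F. x \<in> J}" by (auto simp: not_le)
    define H where "H = {J\<in>F. x \<in> J}"
    have "finite H" using psubset.hyps unfolding H_def by auto
    moreover have "H \<noteq> {}" using x unfolding H_def[symmetric] by auto
    ultimately have H: "finite H" "H \<noteq> {}" by auto
    from psubset.prems obtain a b where ab: "\<And>J. J \<in> F \<Longrightarrow> J = {a J<..<b J}" by metis
    from H have "Min (a ` H) \<in> a ` H" "Max (b ` H) \<in> b ` H" by auto
    then obtain L R where L: "L \<in> H" "a L = Min (a ` H)" and R: "R \<in> H" "b R = Max (b ` H)"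
      by (metis imageE)
    \<comment> \<open>Since at least three intervals contain \<open>x\<close>, some interval \<open>J\<close> differs from the two extremal ones, which cover it.\<close>
    have "\<not> H \<subseteq> {L, R}"
    proof
      assume "H \<subseteq> {L, R}"
      then have "card H \<le> card {L, R}" by (intro card_mono) auto
      also have "\<dots> \<le> 2" by (simp add: card_insert_if)
      finally show False using x H_def by simp
    qed
    then obtain J where J: "J \<in> H" "J \<noteq> L" "J \<noteq> R" by auto
    have JF: "J \<in> F" "L \<in> F" "R \<in> F" and xs: "x \<in> J" "x \<in> L" "x \<in> R"
      using J L R by (auto simp: H_def)
    have "a L \<le> a J" "b J \<le> b R" using L R J H by auto
    then have "{a J<..<b J} \<subseteq> {a L<..<b L} \<union> {a R<..<b R}"
      using xs ab[OF JF(1), THEN eqset_imp_iff, of x] ab[OF JF(2), THEN eqset_imp_iff, of x]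
        ab[OF JF(3), THEN eqset_imp_iff, of x] by auto
    then have "J \<subseteq> L \<union> R" using ab JF by metis
    then have U: "\<Union>(F - {J}) = \<Union>F" using JF J by blast
    have "F - {J} \<subset> F" using JF by auto
    moreover have "\<exists>a b. K = {a<..<b}" if "K \<in> F - {J}" for K using psubset.prems[of K] that by simp
    ultimately have "\<exists>F'\<subseteq>F - {J}. \<Union>F' = \<Union>(F - {J}) \<and> (\<forall>x. card {J\<in>F'. x \<in> J} \<le> 2)"
      by (rule psubset.IH)
    then show ?thesis unfolding U by (meson Diff_subset order_trans)
  qed
qed

lemma sum_emeasure_overlap_2:
  assumes "finite F" and F: "\<And>J. J \<in> F \<Longrightarrow> J \<in> sets M" and S: "S \<in> sets M"
    and overlap: "\<And>x. card {J\<in>F. x \<in> J} \<le> 2"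
  shows "(\<Sum>J\<in>F. emeasure M (S \<inter> J)) \<le> 2 * emeasure M S"
proof -
  have "(\<Sum>J\<in>F. emeasure M (S \<inter> J)) = (\<Sum>J\<in>F. \<integral>\<^sup>+x. indicator (S \<inter> J) x \<partial>M)"
    using F S by (intro sum.cong) auto
  also have "\<dots> = (\<integral>\<^sup>+x. (\<Sum>J\<in>F. indicator (S \<inter> J) x) \<partial>M)"
    using F S by (intro nn_integral_sum[symmetric]) auto
  also have "\<dots> \<le> (\<integral>\<^sup>+x. 2 * indicator S x \<partial>M)"
  proof (intro nn_integral_mono)
    fix x
    have "(\<Sum>J\<in>F. indicator (S \<inter> J) x :: ennreal) = (\<Sum>J\<in>{J\<in>F. x \<in> J}. indicator S x)"
      using \<open>finite F\<close> by (intro sum.mono_neutral_cong_right) (auto simp: indicator_def)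
    also have "\<dots> = of_nat (card {J\<in>F. x \<in> J}) * indicator S x" by simp
    also have "\<dots> \<le> of_nat 2 * indicator S x"
      using overlap[of x] by (intro mult_right_mono) (simp_all only: of_nat_le_iff zero_le)
    finally show "(\<Sum>J\<in>F. indicator (S \<inter> J) x) \<le> (2 * indicator S x :: ennreal)" by simp
  qed
  also have "\<dots> = 2 * emeasure M S" using S by (simp add: nn_integral_cmult_indicator)
  finally show ?thesis .
qed

text \<open>
  The exponents \<open>1 - 1/p\<close> and \<open>1/p\<close> in the bound on a single interval \<open>J\<close> are chosen such that the
  bounds can be added: with \<open>X = \<Sum>\<mu>(J)\<close> over a subfamily of overlap at most two, Hoelder's
  inequality for each level \<open>l\<close> gives
  \<open>\<Sum> \<mu>(J)^(1 - 1/p) \<mu>(E l \<inter> J)^(1/p) \<le> X^(1 - 1/p) (2 \<mu>(E l))^(1/p)\<close>. The factor \<open>X^(1 - 1/p)\<close> then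
  cancels against \<open>X\<close>. Summing at each level before integrating plays the role of Minkowski's
  inequality and costs no further constant.
\<close>

lemma weak_type_finite_interval_family:
  fixes M :: "real measure" and E :: "real \<Rightarrow> real set" and F :: "real set set"
  assumes sets: "sets M = sets borel" and p: "1 < p" and lam: "0 < lam" and c: "0 \<le> c"
    and E: "\<And>l. E l \<in> sets borel"
    and E_meas: "\<And>J. J \<in> sets borel \<Longrightarrow> (\<lambda>l. emeasure M (E l \<inter> J)) \<in> borel_measurable borel"
    and fin: "finite F"
    and F: "\<And>J. J \<in> F \<Longrightarrow> \<exists>a b. J = {a<..<b}"
    and F_fin: "\<And>J. J \<in> F \<Longrightarrow> emeasure M J < top"
    and bound: "\<And>J. J \<in> F \<Longrightarrow> ennreal lam * emeasure M J \<le> ennreal c *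
       (\<integral>\<^sup>+l\<in>{0<..}. ennreal (measure M J powr (1 - 1/p) * measure M (E l \<inter> J) powr (1/p)) \<partial>lborel)"
  shows "ennreal lam * ennpowr (emeasure M (\<Union>F)) (1/p)
     \<le> ennreal (c * 2 powr (1/p)) * (\<integral>\<^sup>+l\<in>{0<..}. ennpowr (emeasure M (E l)) (1/p) \<partial>lborel)"
proof -
  obtain F' where F': "F' \<subseteq> F" "\<Union>F' = \<Union>F" and overlap: "\<And>x. card {J\<in>F'. x \<in> J} \<le> 2"
    using finite_interval_cover_overlap_2[OF fin F] by blast
  have fin': "finite F'" using F'(1) fin by (rule finite_subset)
  have J_borel: "J \<in> sets borel" if "J \<in> F'" for J using F[of J] that F'(1) by force
  have [measurable]: "(\<lambda>l. measure M (E l \<inter> J)) \<in> borel_measurable borel" if "J \<in> F'" for J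
    using E_meas[OF J_borel[OF that]] unfolding measure_def by measurable
  have [measurable]: "(\<lambda>l. emeasure M (E l)) \<in> borel_measurable borel" using E_meas[of UNIV] by simp
  have ennp: "ennpowr x (1/p) = (if x = top then top else ennreal (enn2real x powr (1/p)))" for x
    by (simp add: ennpowr_def)
  have T_meas[measurable]: "(\<lambda>l. ennpowr (emeasure M (E l)) (1/p)) \<in> borel_measurable borel"
    unfolding ennp by measurable
  define X where "X = (\<Sum>J\<in>F'. measure M J)"
  define T where "T = (\<integral>\<^sup>+l\<in>{0<..}. ennpowr (emeasure M (E l)) (1/p) \<partial>lborel)"
  have X0: "0 \<le> X" unfolding X_def by (intro sum_nonneg) simp
  have sumE: "ennreal ((\<Sum>J\<in>F'. measure M (E l \<inter> J)) powr (1/p))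
      \<le> ennreal (2 powr (1/p)) * ennpowr (emeasure M (E l)) (1/p)" for l
  proof -
    have "emeasure M (E l \<inter> J) \<noteq> top" if "J \<in> F'" for J
    proof -
      have "emeasure M (E l \<inter> J) \<le> emeasure M J"
        using J_borel[OF that] sets by (intro emeasure_mono) auto
      then show ?thesis using F_fin[of J] that F' by (auto simp: top_unique)
    qed
    then have "ennreal (\<Sum>J\<in>F'. measure M (E l \<inter> J)) = (\<Sum>J\<in>F'. emeasure M (E l \<inter> J))"
      by (subst sum_ennreal[symmetric]) (auto intro!: sum.cong simp: emeasure_eq_ennreal_measure)
    also have "\<dots> \<le> 2 * emeasure M (E l)"
      using fin' J_borel E overlap sets by (intro sum_emeasure_overlap_2) auto
    finally have "ennpowr (ennreal (\<Sum>J\<in>F'. measure M (E l \<inter> J))) (1/p)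
        \<le> ennpowr (ennreal 2 * emeasure M (E l)) (1/p)"
      using p by (intro ennpowr_mono) auto
    then show ?thesis using p by (subst (asm) ennpowr_mult) (auto simp: ennpowr_ennreal sum_nonneg)
  qed
  have eX: "ennreal X = (\<Sum>J\<in>F'. emeasure M J)"
  proof -
    have "emeasure M J = ennreal (measure M J)" if "J \<in> F'" for J
      using F_fin[of J] that F'(1) by (intro emeasure_eq_ennreal_measure) auto
    then show ?thesis unfolding X_def by (simp add: sum_ennreal)
  qed
  have "ennreal lam * ennreal X = (\<Sum>J\<in>F'. ennreal lam * emeasure M J)"
    by (simp add: eX sum_distrib_left)
  also have "\<dots> \<le> (\<Sum>J\<in>F'. ennreal c *
       (\<integral>\<^sup>+l\<in>{0<..}. ennreal (measure M J powr (1 - 1/p) * measure M (E l \<inter> J) powr (1/p)) \<partial>lborel))"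
    using bound F' by (intro sum_mono) auto
  also have "\<dots> = ennreal c * (\<Sum>J\<in>F'.
       (\<integral>\<^sup>+l\<in>{0<..}. ennreal (measure M J powr (1 - 1/p) * measure M (E l \<inter> J) powr (1/p)) \<partial>lborel))"
    by (simp add: sum_distrib_left)
  also have "\<dots> = ennreal c * (\<integral>\<^sup>+l. (\<Sum>J\<in>F'.
       ennreal (measure M J powr (1 - 1/p) * measure M (E l \<inter> J) powr (1/p)) * indicator {0<..} l) \<partial>lborel)"
    by (subst nn_integral_sum) auto
  also have "\<dots> \<le> ennreal c * (\<integral>\<^sup>+l. ennreal (X powr (1 - 1/p) * 2 powr (1/p)) *
       (ennpowr (emeasure M (E l)) (1/p) * indicator {0<..} l) \<partial>lborel)"
  proof (intro mult_left_mono nn_integral_mono)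
    fix l
    have "(\<Sum>J\<in>F'. ennreal (measure M J powr (1 - 1/p) * measure M (E l \<inter> J) powr (1/p)))
       = ennreal (\<Sum>J\<in>F'. measure M J powr (1 - 1/p) * measure M (E l \<inter> J) powr (1/p))"
      by (subst sum_ennreal) auto
    also have "\<dots> \<le> ennreal (X powr (1 - 1/p) * (\<Sum>J\<in>F'. measure M (E l \<inter> J)) powr (1/p))"
      unfolding X_def using p fin' by (intro ennreal_leI Holder_sum_powr) auto
    also have "\<dots> = ennreal (X powr (1 - 1/p)) * ennreal ((\<Sum>J\<in>F'. measure M (E l \<inter> J)) powr (1/p))"
      by (simp add: ennreal_mult)
    also have "\<dots> \<le> ennreal (X powr (1 - 1/p)) * (ennreal (2 powr (1/p)) * ennpowr (emeasure M (E l)) (1/p))"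
      by (intro mult_left_mono sumE) auto
    finally show "(\<Sum>J\<in>F'. ennreal (measure M J powr (1 - 1/p) * measure M (E l \<inter> J) powr (1/p)) * indicator {0<..} l)
      \<le> ennreal (X powr (1 - 1/p) * 2 powr (1/p)) * (ennpowr (emeasure M (E l)) (1/p) * indicator {0<..} l)"
      by (simp add: sum_distrib_right[symmetric] ennreal_mult mult.assoc[symmetric] mult_right_mono)
  qed auto
  also have "\<dots> = ennreal (X powr (1 - 1/p)) * (ennreal (c * 2 powr (1/p)) * T)"
    using c by (subst nn_integral_cmult) (auto simp: T_def ennreal_mult ac_simps)
  finally have main: "ennreal lam * ennreal X \<le> ennreal (X powr (1 - 1/p)) * (ennreal (c * 2 powr (1/p)) * T)" .
  \<comment> \<open>Cancel \<open>X^(1 - 1/p)\<close>, which is finite because each interval has finite measure.\<close>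
  have XT: "ennreal lam * ennreal (X powr (1/p)) \<le> ennreal (c * 2 powr (1/p)) * T"
  proof (cases "X = 0")
    case False
    then have Xp: "0 < X" using X0 by simp
    have "X = X powr (1 - 1/p) * X powr (1/p)" using Xp by (simp add: powr_add[symmetric])
    then have eq: "ennreal X = ennreal (X powr (1 - 1/p)) * ennreal (X powr (1/p))"
      by (metis ennreal_mult powr_ge_zero)
    have "ennreal (X powr (1 - 1/p)) * (ennreal lam * ennreal (X powr (1/p)))
       \<le> ennreal (X powr (1 - 1/p)) * (ennreal (c * 2 powr (1/p)) * T)"
      using main unfolding eq by (simp add: ac_simps)
    then show ?thesis
      using Xp by (subst (asm) ennreal_mult_le_mult_iff) auto
  qed (use p in simp)
  have "emeasure M (\<Union>F) = emeasure M (\<Union>J\<in>F'. J)" using F' by simp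
  also have "\<dots> \<le> (\<Sum>J\<in>F'. emeasure M J)"
    using fin' J_borel sets by (intro emeasure_subadditive_finite) auto
  also have "\<dots> = ennreal X" by (simp add: eX)
  finally have "ennpowr (emeasure M (\<Union>F)) (1/p) \<le> ennpowr (ennreal X) (1/p)"
    using p by (intro ennpowr_mono) auto
  also have "\<dots> = ennreal (X powr (1/p))" using X0 by (rule ennpowr_ennreal)
  finally have "ennreal lam * ennpowr (emeasure M (\<Union>F)) (1/p) \<le> ennreal lam * ennreal (X powr (1/p))"
    by (intro mult_left_mono) auto
  with XT show ?thesis unfolding T_def by (rule order_trans[rotated])
qed

text \<open>
  By the Lindeloef property the union is that of a sequence of intervals, hence a supremum over
  finite subfamilies; the bound does not depend on the number of intervals.
\<close>

lemma weak_type_interval_family: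
  fixes M :: "real measure" and E :: "real \<Rightarrow> real set" and F :: "real set set"
  assumes sets: "sets M = sets borel" and p: "1 < p" and lam: "0 < lam" and c: "0 \<le> c"
    and E: "\<And>l. E l \<in> sets borel"
    and E_meas: "\<And>J. J \<in> sets borel \<Longrightarrow> (\<lambda>l. emeasure M (E l \<inter> J)) \<in> borel_measurable borel"
    and F: "\<And>J. J \<in> F \<Longrightarrow> \<exists>a b. J = {a<..<b}"
    and F_fin: "\<And>J. J \<in> F \<Longrightarrow> emeasure M J < top"
    and bound: "\<And>J. J \<in> F \<Longrightarrow> ennreal lam * emeasure M J \<le> ennreal c *
       (\<integral>\<^sup>+l\<in>{0<..}. ennreal (measure M J powr (1 - 1/p) * measure M (E l \<inter> J) powr (1/p)) \<partial>lborel)"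
  shows "ennreal lam * ennpowr (emeasure M (\<Union>F)) (1/p)
     \<le> ennreal (c * 2 powr (1/p)) * (\<integral>\<^sup>+l\<in>{0<..}. ennpowr (emeasure M (E l)) (1/p) \<partial>lborel)"
    (is "_ \<le> ?K")
proof -
  have op: "open J" if "J \<in> F" for J using F[OF that] by auto
  obtain F' where F': "F' \<subseteq> F" "countable F'" "\<Union>F' = \<Union>F"
    using Lindelof[of F] op by metis
  have lam': "ennreal lam * z \<le> ?K \<longleftrightarrow> z \<le> ?K / ennreal lam" for z
    using lam by (intro ennreal_mult_le_iff_le_divide) auto
  have goal: "emeasure M (\<Union>F') \<le> ennpowr (?K / ennreal lam) (1 / (1 / p))"
  proof (cases "F' = {}")
    case False
    then obtain A :: "nat \<Rightarrow> real set" where A: "F' = range A" using F'(2) by (metis uncountable_def)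
    have AF: "A i \<in> F" for i using A F'(1) by blast
    have bd: "emeasure M (\<Union>(A ` {..<n})) \<le> ennpowr (?K / ennreal lam) (1 / (1 / p))" for n
    proof -
      have sub: "J \<in> F" if "J \<in> A ` {..<n}" for J using that AF by blast
      have "ennreal lam * ennpowr (emeasure M (\<Union>(A ` {..<n}))) (1/p) \<le> ?K"
        by (rule weak_type_finite_interval_family[OF sets p lam c E E_meas _ F F_fin bound])
          (use sub in blast)+
      then show ?thesis unfolding lam' using p by (subst (asm) ennpowr_le_iff) auto
    qed
    have "emeasure M (\<Union>F') = emeasure M (\<Union>n. \<Union>(A ` {..<n}))"
      using A by (intro arg_cong[where f="emeasure M"]) auto
    also have "\<dots> = (SUP n. emeasure M (\<Union>(A ` {..<n})))"
    proof (rule SUP_emeasure_incseq[symmetric])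
      have "open (A i)" for i using AF by (rule op)
      then have "open (\<Union>(A ` {..<n}))" for n by blast
      then show "range (\<lambda>n. \<Union>(A ` {..<n})) \<subseteq> sets M" using sets by auto
      show "incseq (\<lambda>n. \<Union>(A ` {..<n}))" unfolding incseq_def by (intro allI impI UN_mono) auto
    qed
    also have "\<dots> \<le> ennpowr (?K / ennreal lam) (1 / (1 / p))" by (intro SUP_least bd)
    finally show ?thesis .
  qed simp
  then have "emeasure M (\<Union>F) \<le> ennpowr (?K / ennreal lam) (1 / (1 / p))" unfolding F'(3) .
  then show ?thesis unfolding lam' using p by (subst ennpowr_le_iff) simp_all
qed

section \<open>Radial functions and their profiles\<close>

text \<open>
  The surface area of the unit sphere of \<open>\<real>^n\<close>.
\<close>

definition radial_factor :: "nat \<Rightarrow> real" where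
  "radial_factor n = real n * unit_ball_vol (real n)"

lemma radial_factor_pos: "0 < n \<Longrightarrow> 0 < radial_factor n"
  by (simp add: radial_factor_def unit_ball_vol_pos)

text \<open>
  Both sides give the volume of a ball to \<open>{..r}\<close>, and these half-lines generate the Borel sets.
\<close>

lemma distr_norm_lborel:
  "distr (lborel :: 'a::euclidean_space measure) borel norm =
     density lborel (\<lambda>t. ennreal (radial_factor DIM('a)) * (ennreal (t ^ (DIM('a) - 1)) * indicator {0..} t))"
  (is "?L = ?R")
proof (rule measure_eqI_generator_eq)
  let ?n = "DIM('a)"
  let ?E = "range (\<lambda>r::real. {..r})"
  have norm_le: "emeasure ?L {..r} = ennreal (unit_ball_vol ?n * r ^ ?n)" if "0 \<le> r" for r
  proof -
    have "norm -` {..r} \<inter> space (lborel :: 'a measure) = cball 0 r" by auto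
    then have "emeasure ?L {..r} = emeasure lborel (cball (0::'a) r)"
      by (subst emeasure_distr) auto
    then show ?thesis using that by (simp add: emeasure_cball)
  qed
  show "Int_stable ?E" by (auto simp: Int_stable_def)
  show "?E \<subseteq> Pow UNIV" by auto
  show "sets ?L = sigma_sets UNIV ?E"
    by (simp add: borel_eq_atMost sets_measure_of)
  show "sets ?R = sigma_sets UNIV ?E"
    by (simp add: borel_eq_atMost sets_measure_of)
  show "range (\<lambda>i::nat. {..real i}) \<subseteq> ?E" by auto
  show "(\<Union>i::nat. {..real i}) = UNIV" by (auto intro: real_arch_simple)
  show "emeasure ?L {..real i} \<noteq> \<infinity>" for i :: nat by (subst norm_le) auto
  fix X :: "real set" assume "X \<in> ?E"
  then obtain r where X: "X = {..r}" by auto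
  show "emeasure ?L X = emeasure ?R X"
  proof (cases "0 \<le> r")
    case False
    then have "norm -` {..r} \<inter> space (lborel :: 'a measure) = {}"
      by (auto simp: not_le) (meson norm_ge_zero not_le order_trans)
    then have "emeasure ?L X = 0" unfolding X by (subst emeasure_distr) auto
    moreover have "emeasure ?R X = 0"
      unfolding X using False by (subst emeasure_density) (auto simp: indicator_def nn_integral_0_iff_AE)
    ultimately show ?thesis by simp
  next
    case True
    have n: "real ?n > 0" by simp
    have "emeasure ?R X = ennreal (radial_factor ?n) * (\<integral>\<^sup>+t. ennreal (t ^ (?n - 1)) * indicator {0..r} t \<partial>lborel)"
      unfolding X
      by (subst emeasure_density)
         (auto simp: nn_integral_cmult[symmetric] indicator_def intro!: nn_integral_cong)
    also have "(\<integral>\<^sup>+t. ennreal (t ^ (?n - 1)) * indicator {0..r} t \<partial>lborel) = ennreal (r ^ ?n / ?n - 0 ^ ?n / ?n)"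
      using True n
      by (intro nn_integral_FTC_Icc[where F="\<lambda>t. t ^ ?n / ?n"]) (auto intro!: derivative_eq_intros)
    also have "ennreal (radial_factor ?n) * \<dots> = ennreal (unit_ball_vol ?n * r ^ ?n)"
      using n True
      by (simp add: radial_factor_def ennreal_mult[symmetric] zero_power divide_simps)
    finally show ?thesis unfolding X using norm_le[OF True] by simp
  qed
qed

lemma nn_integral_radial:
  fixes F :: "real \<Rightarrow> ennreal"
  assumes [measurable]: "F \<in> borel_measurable borel"
  shows "(\<integral>\<^sup>+x. F (norm (x::'a::euclidean_space)) \<partial>lborel) =
    ennreal (radial_factor DIM('a)) * (\<integral>\<^sup>+t\<in>{0..}. ennreal (t ^ (DIM('a) - 1)) * F t \<partial>lborel)"
proof -
  have "(\<integral>\<^sup>+x. F (norm (x::'a)) \<partial>lborel) = (\<integral>\<^sup>+t. F t \<partial>distr (lborel :: 'a measure) borel norm)"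
    by (subst nn_integral_distr) auto
  also have "\<dots> = (\<integral>\<^sup>+t. ennreal (radial_factor DIM('a)) *
      (ennreal (t ^ (DIM('a) - 1)) * F t * indicator {0..} t) \<partial>lborel)"
    unfolding distr_norm_lborel by (subst nn_integral_density) (auto simp: ac_simps)
  also have "\<dots> = ennreal (radial_factor DIM('a)) *
      (\<integral>\<^sup>+t\<in>{0..}. ennreal (t ^ (DIM('a) - 1)) * F t \<partial>lborel)"
    by (subst nn_integral_cmult) auto
  finally show ?thesis .
qed

lemma AE_radial_iff:
  assumes [measurable]: "Measurable.pred borel P"
  shows "(AE x in (lborel :: 'a::euclidean_space measure). P (norm x)) \<longleftrightarrow> (AE t in lborel. 0 \<le> t \<longrightarrow> P t)"
proof -
  have ne: "AE t::real in lborel. t \<noteq> 0" by (rule AE_lborel_singleton)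
  have "(AE x in (lborel :: 'a measure). P (norm x)) \<longleftrightarrow> (AE t in distr (lborel :: 'a measure) borel norm. P t)"
    using assms by (subst AE_distr_iff) auto
  also have "\<dots> \<longleftrightarrow> (AE t in lborel. 0 < ennreal (radial_factor DIM('a)) *
      (ennreal (t ^ (DIM('a) - 1)) * indicator {0..} t) \<longrightarrow> P t)"
    unfolding distr_norm_lborel by (subst AE_density) auto
  also have "\<dots> \<longleftrightarrow> (AE t in lborel. 0 \<le> t \<longrightarrow> P t)"
  proof
    assume *: "AE t in lborel. 0 < ennreal (radial_factor DIM('a)) *
      (ennreal (t ^ (DIM('a) - 1)) * indicator {0..} t) \<longrightarrow> P t"
    show "AE t in lborel. 0 \<le> t \<longrightarrow> P t"
      using ne *
    proof eventually_elim
      case (elim t)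
      have "0 < ennreal (radial_factor DIM('a)) * (ennreal (t ^ (DIM('a) - 1)) * indicator {0..} t)"
        if "0 < t"
        using that radial_factor_pos[of "DIM('a)"] by (simp add: ennreal_zero_less_mult_iff)
      with elim show ?case by auto
    qed
  next
    assume "AE t in lborel. 0 \<le> t \<longrightarrow> P t"
    then show "AE t in lborel. 0 < ennreal (radial_factor DIM('a)) *
      (ennreal (t ^ (DIM('a) - 1)) * indicator {0..} t) \<longrightarrow> P t"
      by eventually_elim (auto simp: indicator_def split: if_splits)
  qed
  finally show ?thesis .
qed

lemma norm_image_fsigma_borel:
  fixes C :: "'a::euclidean_space set"
  assumes "fsigma C"
  shows "norm ` C \<in> sets borel"
proof -
  obtain K :: "nat \<Rightarrow> 'a set" where K: "\<And>i. compact (K i)" "C = (\<Union>i. K i)"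
    using fsigma_Union_compact[THEN iffD1, OF assms] by (auto simp: image_subset_iff)
  have "norm ` C = (\<Union>i. norm ` K i)" using K by auto
  also have "\<dots> \<in> sets borel"
    using K by (intro sets.countable_UN) (auto intro!: borel_compact compact_continuous_image continuous_intros)
  finally show ?thesis .
qed

text \<open>
  The set is an \<open>F\<^sub>\<sigma>\<close>, that is, a countable union of compact sets, up to a null set, and the norm
  maps compact sets to compact sets. The image of this \<open>F\<^sub>\<sigma>\<close> is \<open>B\<close>; radial symmetry keeps it
  inside \<open>S\<close>.
\<close>

lemma radial_set_borel_core:
  assumes "{x :: 'a::euclidean_space. norm x \<in> S} \<in> sets lebesgue"
  obtains B where "B \<in> sets borel" "B \<subseteq> S" "AE x in (lebesgue :: 'a measure). norm x \<in> S \<longrightarrow> norm x \<in> B"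
proof -
  obtain C T where CT: "fsigma C" "T \<in> null_sets lebesgue" "C \<union> T = {x :: 'a. norm x \<in> S}"
    using lebesgue_set_almost_fsigma[OF assms] by (metis (no_types, lifting))
  show thesis
  proof
    show "norm ` C \<in> sets borel" using CT by (intro norm_image_fsigma_borel)
    show "norm ` C \<subseteq> S" using CT(3) by auto
    have "AE x in lebesgue. x \<notin> T" using CT(2) by (rule AE_not_in)
    then show "AE x in (lebesgue :: 'a measure). norm x \<in> S \<longrightarrow> norm x \<in> norm ` C"
      by eventually_elim (use CT(3) in blast)
  qed
qed

text \<open>
  Exhausting both \<open>S\<close> and its complement by Borel sets leaves between them a Borel set whose
  preimage under the norm is null. By integration in polar coordinates it is itself null.
\<close>

lemma radial_set_measurable_profile:
  assumes S: "{x :: 'a::euclidean_space. norm x \<in> S} \<in> sets lebesgue"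
  shows "S \<inter> {0..} \<in> sets lebesgue"
proof -
  have "{x :: 'a. norm x \<in> - S} = space lebesgue - {x :: 'a. norm x \<in> S}" by auto
  also have "\<dots> \<in> sets lebesgue" using S by (rule sets.compl_sets)
  finally have S': "{x :: 'a. norm x \<in> - S} \<in> sets lebesgue" .
  obtain B where B: "B \<in> sets borel" "B \<subseteq> S" "AE x in (lebesgue :: 'a measure). norm x \<in> S \<longrightarrow> norm x \<in> B"
    using radial_set_borel_core[OF S] .
  obtain D where D: "D \<in> sets borel" "D \<subseteq> - S" "AE x in (lebesgue :: 'a measure). norm x \<in> - S \<longrightarrow> norm x \<in> D"
    using radial_set_borel_core[OF S'] .
  have "AE x in (lebesgue :: 'a measure). norm x \<in> B \<union> D"
    using B(3) D(3) by eventually_elim auto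
  then have "AE x in (lborel :: 'a measure). norm x \<in> B \<union> D" by (simp add: AE_completion_iff)
  then have ae: "AE t in lborel. 0 \<le> t \<longrightarrow> t \<in> B \<union> D"
    using B D by (subst (asm) AE_radial_iff) (auto simp: pred_def)
  have "{t \<in> space lborel. \<not> (0 \<le> t \<longrightarrow> t \<in> B \<union> D)} \<in> null_sets lborel"
    using ae B(1) D(1) by (subst AE_iff_null[symmetric]) auto
  then have "S \<inter> {0..} - B \<in> null_sets lebesgue"
    using B D by (intro null_sets_completion_subset[OF _ null_sets_completionI]) auto
  then have "(S \<inter> {0..} - B) \<union> (B \<inter> {0..}) \<in> sets lebesgue" using B(1) by auto
  moreover have "(S \<inter> {0..} - B) \<union> (B \<inter> {0..}) = S \<inter> {0..}" using B(2) by auto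
  ultimately show ?thesis by simp
qed

text \<open>
  A radial function and its profile may thus be assumed Borel, at the cost of a null set of
  radii.
\<close>

lemma radial_borel_profile:
  fixes g :: "'a::euclidean_space \<Rightarrow> real" and g0 :: "real \<Rightarrow> real"
  assumes g: "g \<in> borel_measurable lebesgue" and g0: "\<And>x. g x = g0 (norm x)"
  obtains g1 where "g1 \<in> borel_measurable borel" "AE t in lborel. 0 \<le> t \<longrightarrow> g0 t = g1 t"
proof -
  define h where "h t = (if 0 \<le> t then g0 t else 0)" for t
  have "h \<in> borel_measurable lebesgue"
  proof (rule measurableI)
    fix A :: "real set" assume A: "A \<in> sets borel"
    have "{x :: 'a. norm x \<in> g0 -` A} = g -` A \<inter> space lebesgue" using g0 by auto
    also have "\<dots> \<in> sets lebesgue" using g A by (rule measurable_sets)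
    finally have "g0 -` A \<inter> {0..} \<in> sets lebesgue" by (rule radial_set_measurable_profile)
    moreover have "h -` A \<inter> space lebesgue = (g0 -` A \<inter> {0..}) \<union> (if 0 \<in> A then {..<0} else {})"
      by (auto simp: h_def split: if_splits)
    ultimately show "h -` A \<inter> space lebesgue \<in> sets lebesgue" by auto
  qed auto
  then obtain g1 where g1: "g1 \<in> borel_measurable lborel" "AE t in lborel. h t = g1 t"
    by (auto dest: completion_ex_borel_measurable_real)
  from g1(2) have "AE t in lborel. 0 \<le> t \<longrightarrow> g0 t = g1 t"
    by eventually_elim (auto simp: h_def split: if_splits)
  with g1(1) show thesis by (intro that) auto
qed

lemma AE_norm_of_profile:
  assumes "AE t in lborel. 0 \<le> t \<longrightarrow> P t"
  shows "AE x in (lborel :: 'a::euclidean_space measure). P (norm x)"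
proof -
  obtain N where N: "N \<in> null_sets lborel" "{t. \<not> (0 \<le> t \<longrightarrow> P t)} \<subseteq> N"
    using assms unfolding eventually_ae_filter by auto
  have "AE t in lborel. 0 \<le> t \<longrightarrow> t \<notin> N" using AE_not_in[OF N(1)] by auto
  then have "AE x in (lborel :: 'a measure). norm x \<notin> N"
    using N(1) by (subst AE_radial_iff) (auto simp: pred_def null_sets_def)
  then show ?thesis by eventually_elim (use N(2) norm_ge_zero in blast)
qed

section \<open>Averages over segments and over spherical shells\<close>

text \<open>
  Among all subsets of \<open>[\<alpha>, \<beta>]\<close> of a given measure, the initial segment carries the least mass of
  an increasing density: moving mass into it can only lower the density.
\<close>

lemma nn_integral_increasing_ge_initial_segment:
  fixes p :: "real \<Rightarrow> ennreal"
  assumes p[measurable]: "p \<in> borel_measurable borel"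
    and mono: "\<And>s t. \<alpha> \<le> s \<Longrightarrow> s \<le> t \<Longrightarrow> t \<le> \<beta> \<Longrightarrow> p s \<le> p t"
    and S[measurable]: "S \<in> sets borel" and sub: "S \<subseteq> {\<alpha>..\<beta>}" and le: "\<alpha> \<le> \<beta>"
  shows "(\<integral>\<^sup>+s\<in>{\<alpha>..\<alpha> + measure lborel S}. p s \<partial>lborel) \<le> (\<integral>\<^sup>+s\<in>S. p s \<partial>lborel)"
proof -
  define m where "m = measure lborel S"
  define I where "I = {\<alpha>..\<alpha> + m}"
  define q where "q = p (\<alpha> + m)"
  have [measurable]: "I \<in> sets borel" by (simp add: I_def)
  have m0: "0 \<le> m" by (simp add: m_def)
  have S_fin: "emeasure lborel S < top"
    using emeasure_mono[OF sub, of lborel] by (auto simp: le intro: order_le_less_trans)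
  then have Sm: "emeasure lborel S = ennreal m" by (auto simp: m_def emeasure_eq_ennreal_measure)
  have "ennreal m \<le> ennreal (\<beta> - \<alpha>)"
    using emeasure_mono[OF sub, of lborel] le unfolding Sm by simp
  then have m_le: "m \<le> \<beta> - \<alpha>" using le by (simp add: ennreal_le_iff)
  have Im: "emeasure lborel I = ennreal m" using m0 by (simp add: I_def)
  have IS_fin: "emeasure lborel (I \<inter> S) \<noteq> top"
    using emeasure_mono[of "I \<inter> S" S lborel] S_fin by (auto simp: top_unique)
  have "emeasure lborel (I - S) = emeasure lborel I - emeasure lborel (I \<inter> S)"
    using IS_fin by (subst emeasure_Diff[symmetric]) (auto simp: Diff_Int_distrib intro: arg_cong)
  also have "\<dots> = emeasure lborel S - emeasure lborel (I \<inter> S)" by (simp add: Im Sm)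
  also have "\<dots> = emeasure lborel (S - I)"
    using IS_fin by (subst emeasure_Diff[symmetric]) (auto intro!: arg_cong[where f="emeasure lborel"])
  finally have diff: "emeasure lborel (I - S) = emeasure lborel (S - I)" .
  have "(\<integral>\<^sup>+s\<in>I. p s \<partial>lborel) = (\<integral>\<^sup>+s. p s * indicator (I \<inter> S) s + p s * indicator (I - S) s \<partial>lborel)"
    by (intro nn_integral_cong) (auto simp: indicator_def)
  also have "\<dots> = (\<integral>\<^sup>+s\<in>I \<inter> S. p s \<partial>lborel) + (\<integral>\<^sup>+s\<in>I - S. p s \<partial>lborel)"
    by (intro nn_integral_add) auto
  also have "(\<integral>\<^sup>+s\<in>I - S. p s \<partial>lborel) \<le> (\<integral>\<^sup>+s. q * indicator (I - S) s \<partial>lborel)"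
    using m_le by (intro nn_integral_mono) (auto simp: I_def q_def indicator_def intro!: mono)
  also have "(\<integral>\<^sup>+s. q * indicator (I - S) s \<partial>lborel) = (\<integral>\<^sup>+s. q * indicator (S - I) s \<partial>lborel)"
    using diff by (simp add: nn_integral_cmult_indicator)
  also have "\<dots> \<le> (\<integral>\<^sup>+s\<in>S - I. p s \<partial>lborel)"
    using m0 sub by (intro nn_integral_mono) (auto simp: I_def q_def indicator_def intro!: mono)
  also have "(\<integral>\<^sup>+s\<in>I \<inter> S. p s \<partial>lborel) + (\<integral>\<^sup>+s\<in>S - I. p s \<partial>lborel)
      = (\<integral>\<^sup>+s. p s * indicator (I \<inter> S) s + p s * indicator (S - I) s \<partial>lborel)"
    by (intro nn_integral_add[symmetric]) auto
  also have "\<dots> = (\<integral>\<^sup>+s\<in>S. p s \<partial>lborel)"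
    by (intro nn_integral_cong) (auto simp: indicator_def)
  finally show ?thesis by (simp add: I_def m_def add_left_mono)
qed

text \<open>
  By monotonicity the worst set \<open>S\<close> is an initial segment of length \<open>\<theta> (\<beta> - \<alpha>)\<close>, and shrinking
  \<open>[\<alpha>, \<beta>]\<close> to this segment costs a factor \<open>\<theta>\<close> from the length and a factor \<open>\<theta>^k\<close> from the density.
\<close>

lemma power_density_of_subset:
  fixes p :: "real \<Rightarrow> ennreal"
  assumes p[measurable]: "p \<in> borel_measurable borel"
    and mono: "\<And>s t. \<alpha> \<le> s \<Longrightarrow> s \<le> t \<Longrightarrow> t \<le> \<beta> \<Longrightarrow> p s \<le> p t"
    and scale: "\<And>\<theta> y. 0 \<le> \<theta> \<Longrightarrow> \<theta> \<le> 1 \<Longrightarrow> 0 \<le> y \<Longrightarrow> ennreal (\<theta> ^ k) * p (\<alpha> + y) \<le> p (\<alpha> + \<theta> * y)"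
    and S[measurable]: "S \<in> sets borel" and sub: "S \<subseteq> {\<alpha>..\<beta>}" and less: "\<alpha> < \<beta>"
  shows "ennreal ((measure lborel S / (\<beta> - \<alpha>)) ^ Suc k) * (\<integral>\<^sup>+s\<in>{\<alpha>..\<beta>}. p s \<partial>lborel)
    \<le> (\<integral>\<^sup>+s\<in>S. p s \<partial>lborel)"
proof -
  define L m \<theta> where "L = \<beta> - \<alpha>" and "m = measure lborel S" and "\<theta> = m / L"
  have L: "0 < L" using less by (simp add: L_def)
  have "m \<le> measure lborel {\<alpha>..\<beta>}"
    unfolding m_def using less by (intro measure_mono_fmeasurable sub) (auto simp: fmeasurable_def)
  then have m: "0 \<le> m" "m \<le> L" using less by (auto simp: m_def L_def)
  have \<theta>: "0 \<le> \<theta>" "\<theta> \<le> 1" "\<theta> * L = m" using L m by (auto simp: \<theta>_def)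
  show ?thesis
  proof (cases "\<theta> = 0")
    case True
    then have "measure lborel S / (\<beta> - \<alpha>) = 0" by (simp only: \<theta>_def m_def L_def)
    then show ?thesis by (simp only: power_Suc mult_zero_left ennreal_0 zero_le)
  next
    case False
    with \<theta> have pos: "0 < \<theta>" by simp
    have "ennreal (\<theta> ^ Suc k) * (\<integral>\<^sup>+s\<in>{\<alpha>..\<beta>}. p s \<partial>lborel)
        = ennreal (\<theta> ^ Suc k) * (\<integral>\<^sup>+y. p (\<alpha> + y) * indicator {0..L} y \<partial>lborel)"
      by (subst nn_integral_real_affine[where t=\<alpha> and c=1])
         (auto simp: L_def indicator_def intro!: arg_cong2[where f="(*)"] nn_integral_cong)
    also have "\<dots> = ennreal \<theta> * (\<integral>\<^sup>+y. ennreal (\<theta> ^ k) * p (\<alpha> + y) * indicator {0..L} y \<partial>lborel)"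
      using \<theta> by (simp add: ennreal_mult mult.assoc nn_integral_cmult)
    also have "\<dots> \<le> ennreal \<theta> * (\<integral>\<^sup>+y. p (\<alpha> + \<theta> * y) * indicator {0..L} y \<partial>lborel)"
      using \<theta> by (intro mult_left_mono nn_integral_mono) (auto simp: indicator_def intro!: scale)
    also have "\<dots> = ennreal \<theta> * (\<integral>\<^sup>+y. p (\<alpha> + \<theta> * y) * indicator {\<alpha>..\<alpha> + m} (\<alpha> + \<theta> * y) \<partial>lborel)"
      using pos by (intro arg_cong2[where f="(*)"] nn_integral_cong refl)
        (auto simp: indicator_def zero_le_mult_iff \<theta>(3)[symmetric])
    also have "\<dots> = (\<integral>\<^sup>+s\<in>{\<alpha>..\<alpha> + m}. p s \<partial>lborel)"
      using pos by (subst nn_integral_real_affine[where t=\<alpha> and c=\<theta>]) auto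
    also have "\<dots> \<le> (\<integral>\<^sup>+s\<in>S. p s \<partial>lborel)"
      unfolding m_def using p mono S sub less
      by (intro nn_integral_increasing_ge_initial_segment) auto
    finally show ?thesis by (simp add: \<theta>_def m_def L_def)
  qed
qed

text \<open>
  Along a line at distance \<open>h\<close> from the origin, the point at distance \<open>s\<close> from the foot of the
  perpendicular has norm \<open>t = sqrt (h\<^sup>2 + s\<^sup>2)\<close>, and \<open>t dt = s ds\<close>. The density \<open>t^(n - 1) dt\<close>
  becomes \<open>s t^(n - 2) ds\<close>, which is increasing in \<open>s\<close>; this uses \<open>n \<ge> 2\<close>.
\<close>

lemma nn_integral_distance_substitution:
  fixes F :: "real \<Rightarrow> ennreal"
  assumes F[measurable]: "F \<in> borel_measurable borel"
    and h: "0 \<le> h" and \<alpha>: "0 \<le> \<alpha>" "\<alpha> < \<beta>" and n: "2 \<le> n"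
  shows "(\<integral>\<^sup>+t\<in>{sqrt (h\<^sup>2 + \<alpha>\<^sup>2)..sqrt (h\<^sup>2 + \<beta>\<^sup>2)}. ennreal (t ^ (n - 1)) * F t \<partial>lborel)
    = (\<integral>\<^sup>+s\<in>{\<alpha>..\<beta>}. ennreal (s * sqrt (h\<^sup>2 + s\<^sup>2) ^ (n - 2)) * F (sqrt (h\<^sup>2 + s\<^sup>2)) \<partial>lborel)"
proof -
  obtain k where k: "n = Suc (Suc k)" using n by (metis add_2_eq_Suc le_Suc_ex)
  show ?thesis
  proof (cases "h = 0")
    case True
    then show ?thesis using \<alpha> by (auto simp: k indicator_def intro!: nn_integral_cong)
  next
    case False
    with h have h: "0 < h" by simp
    have pos: "0 < h\<^sup>2 + s\<^sup>2" for s using h by (simp add: add_pos_nonneg)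
    have "(\<integral>\<^sup>+t. (ennreal (t ^ (n - 1)) * F t) * indicator {sqrt (h\<^sup>2 + \<alpha>\<^sup>2)..sqrt (h\<^sup>2 + \<beta>\<^sup>2)} t \<partial>lborel)
      = (\<integral>\<^sup>+s. (ennreal (sqrt (h\<^sup>2 + s\<^sup>2) ^ (n - 1)) * F (sqrt (h\<^sup>2 + s\<^sup>2)))
          * ennreal (s / sqrt (h\<^sup>2 + s\<^sup>2)) * indicator {\<alpha>..\<beta>} s \<partial>lborel)"
    proof (rule nn_integral_substitution_aux)
      show "((\<lambda>s. sqrt (h\<^sup>2 + s\<^sup>2)) has_real_derivative s / sqrt (h\<^sup>2 + s\<^sup>2)) (at s)" for s
        using pos[of s] by (auto intro!: derivative_eq_intros simp: field_simps)
      have "sqrt (h\<^sup>2 + s\<^sup>2) \<noteq> 0" for s using pos[of s] h by simp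
      then show "continuous_on {\<alpha>..\<beta>} (\<lambda>s. s / sqrt (h\<^sup>2 + s\<^sup>2))"
        by (intro continuous_intros) auto
    qed (use \<alpha> in auto)
    also have "\<dots> = (\<integral>\<^sup>+s\<in>{\<alpha>..\<beta>}. ennreal (s * sqrt (h\<^sup>2 + s\<^sup>2) ^ (n - 2)) * F (sqrt (h\<^sup>2 + s\<^sup>2)) \<partial>lborel)"
    proof (intro nn_integral_cong)
      fix s
      have eq: "sqrt (h\<^sup>2 + s\<^sup>2) ^ (n - 1) * (s / sqrt (h\<^sup>2 + s\<^sup>2)) = s * sqrt (h\<^sup>2 + s\<^sup>2) ^ (n - 2)"
        using pos[of s] by (simp add: k)
      let ?A = "ennreal (sqrt (h\<^sup>2 + s\<^sup>2) ^ (n - 1))" and ?B = "ennreal (s / sqrt (h\<^sup>2 + s\<^sup>2))"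
        and ?R = "ennreal (s * sqrt (h\<^sup>2 + s\<^sup>2) ^ (n - 2))" and ?F = "F (sqrt (h\<^sup>2 + s\<^sup>2))"
      show "?A * ?F * ?B * indicator {\<alpha>..\<beta>} s = ?R * ?F * indicator {\<alpha>..\<beta>} s"
      proof (cases "s \<in> {\<alpha>..\<beta>}")
        case True
        then have "0 \<le> s / sqrt (h\<^sup>2 + s\<^sup>2)" "0 \<le> sqrt (h\<^sup>2 + s\<^sup>2) ^ (n - 1)" using \<alpha> by simp_all
        then have "?A * ?B = ?R" unfolding eq[symmetric] by (intro ennreal_mult[symmetric])
        moreover have "?A * ?F * ?B = ?A * ?B * ?F" by (simp only: mult.assoc mult.commute[of ?F])
        ultimately show ?thesis by (simp only:)
      qed (simp only: indicator_simps mult_zero_right not_False_eq_True)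
    qed
    finally show ?thesis .
  qed
qed

text \<open>
  The geometric core: a radial set occupying the fraction \<open>\<theta>\<close> of a segment on one side of the
  foot of the perpendicular occupies at least the fraction \<open>\<theta>^n\<close> of the shell swept out by the
  segment. The density \<open>p\<close> on the line satisfies the scaling condition with exponent \<open>n - 1\<close>, since
  \<open>\<theta> sqrt (h\<^sup>2 + (\<alpha> + y)\<^sup>2) \<le> sqrt (h\<^sup>2 + (\<alpha> + \<theta> y)\<^sup>2)\<close>.
\<close>

lemma line_fraction_le_shell_fraction:
  assumes E[measurable]: "E \<in> sets borel"
    and h: "0 \<le> h" and \<alpha>: "0 \<le> \<alpha>" "\<alpha> < \<beta>" and n: "2 \<le> n"
  defines "I \<equiv> {sqrt (h\<^sup>2 + \<alpha>\<^sup>2)..sqrt (h\<^sup>2 + \<beta>\<^sup>2)}"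
  shows "ennreal ((measure lborel ({\<alpha>..\<beta>} \<inter> {s. sqrt (h\<^sup>2 + s\<^sup>2) \<in> E}) / (\<beta> - \<alpha>)) ^ n)
      * (\<integral>\<^sup>+t\<in>I. ennreal (t ^ (n - 1)) \<partial>lborel)
    \<le> (\<integral>\<^sup>+t\<in>E \<inter> I. ennreal (t ^ (n - 1)) \<partial>lborel)"
proof -
  define g where "g s = sqrt (h\<^sup>2 + s\<^sup>2)" for s
  define p where "p s = ennreal (s * g s ^ (n - 2))" for s
  define S where "S = {\<alpha>..\<beta>} \<inter> {s. g s \<in> E}"
  obtain k where k: "n = Suc (Suc k)" using n by (metis add_2_eq_Suc le_Suc_ex)
  have [measurable]: "g \<in> borel_measurable borel" unfolding g_def by measurable
  have [measurable]: "p \<in> borel_measurable borel" unfolding p_def by measurable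
  have S: "S \<in> sets borel" unfolding S_def by measurable
  have g0: "0 \<le> g s" for s by (simp add: g_def)
  have g_mono: "g s \<le> g t" if "0 \<le> s" "s \<le> t" for s t
    using that by (simp add: g_def power_mono)
  have g_scale: "\<theta> * g (\<alpha> + y) \<le> g (\<alpha> + \<theta> * y)" if "0 \<le> \<theta>" "\<theta> \<le> 1" "0 \<le> y" for \<theta> y
  proof -
    have "\<theta> * g (\<alpha> + y) = sqrt ((\<theta> * h)\<^sup>2 + (\<theta> * (\<alpha> + y))\<^sup>2)"
      using that by (simp add: g_def power_mult_distrib distrib_left[symmetric] real_sqrt_mult)
    also have "\<dots> \<le> g (\<alpha> + \<theta> * y)"
      unfolding g_def using that \<alpha> h
      by (intro real_sqrt_le_mono add_mono power_mono)
         (auto simp: distrib_left mult_left_le_one_le)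
    finally show ?thesis .
  qed
  have "ennreal ((measure lborel S / (\<beta> - \<alpha>)) ^ Suc (n - 1)) * (\<integral>\<^sup>+s\<in>{\<alpha>..\<beta>}. p s \<partial>lborel)
    \<le> (\<integral>\<^sup>+s\<in>S. p s \<partial>lborel)"
  proof (rule power_density_of_subset)
    show "p s \<le> p t" if "\<alpha> \<le> s" "s \<le> t" for s t
      unfolding p_def using that \<alpha> g0 g_mono by (intro ennreal_leI mult_mono power_mono) auto
    show "ennreal (\<theta> ^ (n - 1)) * p (\<alpha> + y) \<le> p (\<alpha> + \<theta> * y)" if "0 \<le> \<theta>" "\<theta> \<le> 1" "0 \<le> y" for \<theta> y
    proof -
      have "\<theta> ^ (n - 1) * ((\<alpha> + y) * g (\<alpha> + y) ^ (n - 2)) = (\<theta> * (\<alpha> + y)) * (\<theta> * g (\<alpha> + y)) ^ (n - 2)"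
        by (simp add: k power_mult_distrib)
      also have "\<dots> \<le> (\<alpha> + \<theta> * y) * g (\<alpha> + \<theta> * y) ^ (n - 2)"
        using that \<alpha> g0 g_scale by (intro mult_mono power_mono) (auto simp: distrib_left mult_left_le_one_le)
      finally show ?thesis
        unfolding p_def using that \<alpha> g0 by (subst ennreal_mult[symmetric]) (auto intro!: ennreal_leI)
    qed
  qed (use S \<alpha> S_def in auto)
  moreover have "(\<integral>\<^sup>+t\<in>I. ennreal (t ^ (n - 1)) \<partial>lborel) = (\<integral>\<^sup>+s\<in>{\<alpha>..\<beta>}. p s \<partial>lborel)"
    using nn_integral_distance_substitution[of "\<lambda>_. 1" h \<alpha> \<beta> n] h \<alpha> n by (simp add: I_def p_def g_def)
  moreover have "(\<integral>\<^sup>+t\<in>E \<inter> I. ennreal (t ^ (n - 1)) \<partial>lborel) = (\<integral>\<^sup>+s\<in>S. p s \<partial>lborel)"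
  proof -
    have "(\<integral>\<^sup>+t\<in>E \<inter> I. ennreal (t ^ (n - 1)) \<partial>lborel) = (\<integral>\<^sup>+t\<in>I. ennreal (t ^ (n - 1)) * indicator E t \<partial>lborel)"
      by (intro nn_integral_cong) (auto simp: indicator_def)
    also have "\<dots> = (\<integral>\<^sup>+s\<in>{\<alpha>..\<beta>}. p s * indicator E (g s) \<partial>lborel)"
      using nn_integral_distance_substitution[of "indicator E" h \<alpha> \<beta> n] h \<alpha> n by (simp add: I_def p_def g_def)
    also have "\<dots> = (\<integral>\<^sup>+s\<in>S. p s \<partial>lborel)"
      by (intro nn_integral_cong) (auto simp: indicator_def S_def)
    finally show ?thesis .
  qed
  ultimately show ?thesis using n by (simp add: S_def g_def)
qed

lemma nn_integral_reflect:
  fixes H :: "real \<Rightarrow> ennreal"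
  assumes [measurable]: "H \<in> borel_measurable borel" and even: "\<And>s. H (- s) = H s"
  shows "(\<integral>\<^sup>+s\<in>{a..b}. H s \<partial>lborel) = (\<integral>\<^sup>+s\<in>{- b..- a}. H s \<partial>lborel)"
  by (subst nn_integral_real_affine[where t=0 and c="-1"])
     (auto simp: even indicator_def intro!: nn_integral_cong)

lemma norm_along_line:
  fixes x u :: "'a::real_inner"
  assumes u: "norm u = 1"
  obtains h c where "0 \<le> h" "\<And>s. norm (x + s *\<^sub>R u) = sqrt (h\<^sup>2 + (s + c)\<^sup>2)"
proof -
  define c where "c = x \<bullet> u"
  define h where "h = sqrt ((norm x)\<^sup>2 - c\<^sup>2)"
  have "\<bar>c\<bar> \<le> norm x" using Cauchy_Schwarz_ineq2[of x u] u by (simp add: c_def)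
  then have "c\<^sup>2 \<le> (norm x)\<^sup>2" by (metis abs_ge_zero power2_abs power_mono)
  then have h: "0 \<le> h" and h2: "h\<^sup>2 = (norm x)\<^sup>2 - c\<^sup>2" by (auto simp: h_def)
  have "norm (x + s *\<^sub>R u) = sqrt (h\<^sup>2 + (s + c)\<^sup>2)" for s
  proof -
    have "(norm (x + s *\<^sub>R u))\<^sup>2 = (norm x)\<^sup>2 + 2 * s * c + s\<^sup>2 * (norm u)\<^sup>2"
      unfolding power2_norm_eq_inner
      by (simp add: inner_add_left inner_add_right c_def inner_commute[of u x] power2_eq_square algebra_simps)
    also have "\<dots> = h\<^sup>2 + (s + c)\<^sup>2" using u by (simp add: h2 power2_sum)
    finally show ?thesis by (metis norm_ge_zero real_sqrt_unique)
  qed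
  with h show thesis by (rule that)
qed

text \<open>
  A segment that meets the foot of the perpendicular in its interior is folded onto its longer
  half \<open>[0, M]\<close>: the integral at most doubles, while the length does not increase. A segment on
  one side of the foot is kept or reflected.
\<close>

lemma line_average_reduction:
  fixes G :: "real \<Rightarrow> ennreal" and x u :: "'a::euclidean_space"
  assumes G[measurable]: "G \<in> borel_measurable borel" and u: "norm u = 1"
    and ab: "a \<le> 0" "0 \<le> b" "a < b"
  obtains h \<alpha> \<beta> where "0 \<le> h" "0 \<le> \<alpha>" "\<alpha> < \<beta>"
    "sqrt (h\<^sup>2 + \<alpha>\<^sup>2) \<le> norm x" "norm x \<le> sqrt (h\<^sup>2 + \<beta>\<^sup>2)"
    "(\<integral>\<^sup>+s\<in>{a..b}. G (norm (x + s *\<^sub>R u)) \<partial>lborel) / ennreal (b - a)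
      \<le> 2 * ((\<integral>\<^sup>+s\<in>{\<alpha>..\<beta>}. G (sqrt (h\<^sup>2 + s\<^sup>2)) \<partial>lborel) / ennreal (\<beta> - \<alpha>))"
proof -
  obtain h c where h: "0 \<le> h" and line: "\<And>s. norm (x + s *\<^sub>R u) = sqrt (h\<^sup>2 + (s + c)\<^sup>2)"
    using norm_along_line[OF u, of x] by blast
  define H where "H s = G (sqrt (h\<^sup>2 + s\<^sup>2))" for s
  define a' b' where "a' = a + c" and "b' = b + c"
  have [measurable]: "H \<in> borel_measurable borel" unfolding H_def by measurable
  have nx: "norm x = sqrt (h\<^sup>2 + c\<^sup>2)" using line[of 0] by simp
  have even: "H (- s) = H s" for s by (simp add: H_def)
  have shift: "(\<integral>\<^sup>+s\<in>{a..b}. G (norm (x + s *\<^sub>R u)) \<partial>lborel) = (\<integral>\<^sup>+s\<in>{a'..b'}. H s \<partial>lborel)"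
    by (subst (2) nn_integral_real_affine[where t=c and c=1])
       (auto simp: line H_def a'_def b'_def indicator_def add.commute intro!: nn_integral_cong)
  have c: "a' \<le> c" "c \<le> b'" "a' < b'" "b - a = b' - a'" using ab by (auto simp: a'_def b'_def)
  have le2: "z \<le> 2 * z" for z :: ennreal using mult_right_mono[of 1 2 z] by simp
  \<comment> \<open>In the coordinate with the foot of the perpendicular at \<open>0\<close>, the segment is \<open>[a', b']\<close> and the point \<open>x\<close> sits at \<open>c\<close>.\<close>
  consider "0 \<le> a'" | "b' \<le> 0" | "a' < 0" "0 < b'" by linarith
  then show thesis
  proof cases
    case 1
    show thesis
    proof (rule that[of h a' b'])
      show "(\<integral>\<^sup>+s\<in>{a..b}. G (norm (x + s *\<^sub>R u)) \<partial>lborel) / ennreal (b - a)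
        \<le> 2 * ((\<integral>\<^sup>+s\<in>{a'..b'}. G (sqrt (h\<^sup>2 + s\<^sup>2)) \<partial>lborel) / ennreal (b' - a'))"
        unfolding shift c(4) H_def by (rule le2)
    qed (use h 1 c nx in \<open>auto intro!: power_mono\<close>)
  next
    case 2
    have reflect: "(\<integral>\<^sup>+s\<in>{a'..b'}. H s \<partial>lborel) = (\<integral>\<^sup>+s\<in>{- b'..- a'}. H s \<partial>lborel)"
      by (rule nn_integral_reflect) (simp_all add: even)
    have diff: "- a' - - b' = b' - a'" by simp
    show thesis
    proof (rule that[of h "- b'" "- a'"])
      show "(\<integral>\<^sup>+s\<in>{a..b}. G (norm (x + s *\<^sub>R u)) \<partial>lborel) / ennreal (b - a)
        \<le> 2 * ((\<integral>\<^sup>+s\<in>{- b'..- a'}. G (sqrt (h\<^sup>2 + s\<^sup>2)) \<partial>lborel) / ennreal (- a' - - b'))"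
        unfolding shift c(4) diff H_def reflect[unfolded H_def] by (rule le2)
      show "sqrt (h\<^sup>2 + (- b')\<^sup>2) \<le> norm x" "norm x \<le> sqrt (h\<^sup>2 + (- a')\<^sup>2)"
        using 2 c power_mono[of "- b'" "- c" 2] power_mono[of "- c" "- a'" 2] by (auto simp: nx)
    qed (use h 2 c in auto)
  next
    case 3
    define M where "M = max (- a') b'"
    have M: "0 < M" "\<bar>c\<bar> \<le> M" "M \<le> b' - a'" "- M \<le> a'" "b' \<le> M" using 3 c by (auto simp: M_def)
    have "(\<integral>\<^sup>+s\<in>{a'..b'}. H s \<partial>lborel) \<le> (\<integral>\<^sup>+s. H s * indicator {- M..- 0} s + H s * indicator {0..M} s \<partial>lborel)"
      using M by (intro nn_integral_mono) (auto simp: indicator_def)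
    also have "\<dots> = (\<integral>\<^sup>+s\<in>{- M..- 0}. H s \<partial>lborel) + (\<integral>\<^sup>+s\<in>{0..M}. H s \<partial>lborel)"
      by (intro nn_integral_add) auto
    also have "\<dots> = 2 * (\<integral>\<^sup>+s\<in>{0..M}. H s \<partial>lborel)"
      by (subst nn_integral_reflect[of H 0 M, OF _ even, symmetric]) (auto simp: mult_2)
    finally have "(\<integral>\<^sup>+s\<in>{a'..b'}. H s \<partial>lborel) / ennreal (b' - a')
        \<le> (2 * (\<integral>\<^sup>+s\<in>{0..M}. H s \<partial>lborel)) / ennreal M"
      using M unfolding divide_ennreal_def
      by (intro mult_mono) (auto simp: inverse_ennreal intro!: ennreal_leI le_imp_inverse_le)
    then show thesis
    proof (intro that[of h 0 M])
      have "\<bar>c\<bar>\<^sup>2 \<le> M\<^sup>2" using M by (intro power_mono) auto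
      then show "norm x \<le> sqrt (h\<^sup>2 + M\<^sup>2)" by (simp add: nx)
    qed (use M h c nx shift in \<open>auto simp: H_def ennreal_times_divide\<close>)
  qed
qed

section \<open>Layer cake and Lorentz quasi-norms\<close>

lemma measurable_superlevel_emeasure:
  fixes f :: "'a \<Rightarrow> ennreal"
  assumes "sigma_finite_measure M" and [measurable]: "f \<in> borel_measurable M" "A \<in> sets M"
  shows "(\<lambda>l. emeasure M ({s\<in>space M. ennreal l < f s} \<inter> A)) \<in> borel_measurable borel"
proof -
  interpret sigma_finite_measure M by fact
  have emeasure_eq: "emeasure M ({s\<in>space M. ennreal l < f s} \<inter> A)
      = (\<integral>\<^sup>+s. (if ennreal l < f s \<and> s \<in> A then 1 else 0) \<partial>M)" for l
  proof -
    have "emeasure M ({s\<in>space M. ennreal l < f s} \<inter> A)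
        = (\<integral>\<^sup>+s. indicator ({s\<in>space M. ennreal l < f s} \<inter> A) s \<partial>M)" by simp
    also have "\<dots> = (\<integral>\<^sup>+s. (if ennreal l < f s \<and> s \<in> A then 1 else 0) \<partial>M)"
      by (rule nn_integral_cong) (auto simp: indicator_def)
    finally show ?thesis .
  qed
  have "(\<lambda>l. emeasure M ({s\<in>space M. ennreal l < f s} \<inter> A))
      = (\<lambda>l. \<integral>\<^sup>+s. (if ennreal l < f s \<and> s \<in> A then 1 else 0) \<partial>M)"
    by (intro ext emeasure_eq)
  also have "\<dots> \<in> borel_measurable borel" by measurable
  finally show ?thesis .
qed

lemma nn_integral_layer_cake:
  fixes f :: "'a \<Rightarrow> ennreal"
  assumes "sigma_finite_measure M" and [measurable]: "f \<in> borel_measurable M" "A \<in> sets M"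
  shows "(\<integral>\<^sup>+s\<in>A. f s \<partial>M) = (\<integral>\<^sup>+l\<in>{0<..}. emeasure M ({s\<in>space M. ennreal l < f s} \<inter> A) \<partial>lborel)"
proof -
  interpret pair_sigma_finite M lborel
    using assms(1) by (simp add: pair_sigma_finite_def lborel.sigma_finite_measure_axioms)
  have emeasure_eq: "emeasure M ({s\<in>space M. ennreal l < f s} \<inter> A)
      = (\<integral>\<^sup>+s. (if ennreal l < f s \<and> s \<in> A then 1 else 0) \<partial>M)" for l
  proof -
    have "emeasure M ({s\<in>space M. ennreal l < f s} \<inter> A)
        = (\<integral>\<^sup>+s. indicator ({s\<in>space M. ennreal l < f s} \<inter> A) s \<partial>M)" by simp
    also have "\<dots> = (\<integral>\<^sup>+s. (if ennreal l < f s \<and> s \<in> A then 1 else 0) \<partial>M)"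
      by (rule nn_integral_cong) (auto simp: indicator_def)
    finally show ?thesis .
  qed
  have slice: "c = (\<integral>\<^sup>+l. (if 0 < l \<and> ennreal l < c then 1 else 0) \<partial>lborel)" for c :: ennreal
  proof (cases c)
    case (real r)
    have "(\<integral>\<^sup>+l. (if 0 < l \<and> ennreal l < c then 1 else 0) \<partial>lborel) = (\<integral>\<^sup>+l. indicator {0<..<r} l \<partial>lborel)"
      using real by (intro nn_integral_cong) (auto simp: indicator_def ennreal_less_iff)
    then show ?thesis using real by simp
  next
    case top
    have "(\<integral>\<^sup>+l. (if 0 < l \<and> ennreal l < c then 1 else 0) \<partial>lborel) = (\<integral>\<^sup>+l. indicator {0::real<..} l \<partial>lborel)"
      using top by (intro nn_integral_cong) (auto simp: indicator_def)
    also have "\<dots> = top"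
    proof -
      have "of_nat n \<le> emeasure lborel {0::real<..}" for n
      proof -
        have "emeasure lborel {0<..<real n} \<le> emeasure lborel {0::real<..}" by (intro emeasure_mono) auto
        then show ?thesis by (simp add: ennreal_of_nat_eq_real_of_nat)
      qed
      then have "(SUP n. of_nat n) \<le> emeasure lborel {0::real<..}" by (intro SUP_least)
      then show ?thesis by (simp add: ennreal_SUP_of_nat_eq_top top_unique)
    qed
    finally show ?thesis using top by simp
  qed
  have "(\<integral>\<^sup>+s\<in>A. f s \<partial>M)
      = (\<integral>\<^sup>+s. (\<integral>\<^sup>+l. (if 0 < l \<and> ennreal l < f s \<and> s \<in> A then 1 else 0) \<partial>lborel) \<partial>M)"
    by (intro nn_integral_cong) (auto simp: indicator_def slice[symmetric])
  also have "\<dots> = (\<integral>\<^sup>+l. (\<integral>\<^sup>+s. (if 0 < l \<and> ennreal l < f s \<and> s \<in> A then 1 else 0) \<partial>M) \<partial>lborel)"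
    by (intro Fubini'[symmetric]) measurable
  also have "\<dots> = (\<integral>\<^sup>+l\<in>{0<..}. emeasure M ({s\<in>space M. ennreal l < f s} \<inter> A) \<partial>lborel)"
    by (intro nn_integral_cong) (auto simp: indicator_def emeasure_eq)
  finally show ?thesis .
qed

text \<open>
  This is \<open>c^a = \<integral>\<^sub>0\<^sup>c a t^(a - 1) dt\<close>, including the case \<open>c = \<infinity>\<close>.
\<close>

lemma nn_integral_superlevel_eq_ennpowr:
  assumes a: "0 < a"
  shows "(\<integral>\<^sup>+t. (if 0 < t \<and> ennreal t < c then ennreal (a * t powr (a - 1)) else 0) \<partial>lborel) = ennpowr c a"
proof -
  have fin: "(\<integral>\<^sup>+t. (if 0 < t \<and> ennreal t < ennreal r then ennreal (a * t powr (a - 1)) else 0) \<partial>lborel)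
      = ennreal (r powr a)" if "0 \<le> r" for r
  proof -
    have "((\<lambda>t. t powr (a - 1)) has_integral (r powr ((a - 1) + 1) / ((a - 1) + 1))) {0..r}"
      using a that by (intro has_integral_powr_from_0) auto
    then have "((\<lambda>t. a * t powr (a - 1)) has_integral (a * (r powr a / a))) {0..r}"
      by (intro has_integral_mult_right) simp
    then have I: "((\<lambda>t. a * t powr (a - 1)) has_integral r powr a) {0..r}" using a by simp
    have "(\<integral>\<^sup>+t. ennreal (a * t powr (a - 1)) * indicator {0..r} t \<partial>lborel) = ennreal (r powr a)"
      using a I by (intro nn_integral_has_integral_lebesgue') auto
    moreover have "(\<integral>\<^sup>+t. (if 0 < t \<and> ennreal t < ennreal r then ennreal (a * t powr (a - 1)) else 0) \<partial>lborel)
        = (\<integral>\<^sup>+t. ennreal (a * t powr (a - 1)) * indicator {0..r} t \<partial>lborel)"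
    proof (rule nn_integral_cong_AE)
      show "AE t in lborel. (if 0 < t \<and> ennreal t < ennreal r then ennreal (a * t powr (a - 1)) else 0)
          = ennreal (a * t powr (a - 1)) * indicator {0..r} t"
        using AE_lborel_singleton[of 0] AE_lborel_singleton[of r]
        by eventually_elim (auto simp: indicator_def ennreal_less_iff)
    qed
    ultimately show ?thesis by simp
  qed
  show ?thesis
  proof (cases c)
    case (real r)
    then show ?thesis using fin[of r] by (simp add: ennpowr_ennreal)
  next
    case top
    have "of_nat k \<le> (\<integral>\<^sup>+t. (if 0 < t \<and> ennreal t < c then ennreal (a * t powr (a - 1)) else 0) \<partial>lborel)" for k
    proof -
      have "of_nat k = ennreal ((real k powr (1 / a)) powr a)"
        using a by (cases "k = 0") (simp_all add: powr_powr ennreal_of_nat_eq_real_of_nat)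
      also have "\<dots> = (\<integral>\<^sup>+t. (if 0 < t \<and> ennreal t < ennreal (real k powr (1 / a)) then ennreal (a * t powr (a - 1)) else 0) \<partial>lborel)"
        by (rule fin[symmetric]) simp
      also have "\<dots> \<le> (\<integral>\<^sup>+t. (if 0 < t \<and> ennreal t < c then ennreal (a * t powr (a - 1)) else 0) \<partial>lborel)"
        using top by (intro nn_integral_mono) auto
      finally show ?thesis .
    qed
    then have "(SUP k. of_nat k) \<le> (\<integral>\<^sup>+t. (if 0 < t \<and> ennreal t < c then ennreal (a * t powr (a - 1)) else 0) \<partial>lborel)"
      by (intro SUP_least)
    then show ?thesis using top by (simp add: ennreal_SUP_of_nat_eq_top top_unique)
  qed
qed

text \<open>
  The set is an initial piece of the half-line, and every \<open>m\<close> competing in the infimum that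
  defines the rearrangement bounds it from above.
\<close>

lemma emeasure_superlevel_le_decreasing_rearrangement:
  assumes "0 \<le> t"
  shows "emeasure lborel {l. 0 < l \<and> ennreal t < wmeasure w {x. ennreal l < g x}} \<le> decreasing_rearrangement w g t"
  unfolding decreasing_rearrangement_def
proof (rule Inf_greatest)
  fix z assume "z \<in> {ennreal l | l. 0 \<le> l \<and> wmeasure w {x. g x > ennreal l} \<le> ennreal t}"
  then obtain m where m: "z = ennreal m" "0 \<le> m" "wmeasure w {x. g x > ennreal m} \<le> ennreal t" by auto
  have "{l. 0 < l \<and> ennreal t < wmeasure w {x. ennreal l < g x}} \<subseteq> {0<..<m}"
  proof safe
    fix l assume l: "0 < l" "ennreal t < wmeasure w {x. ennreal l < g x}"
    show "l \<in> {0<..<m}"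
    proof (rule ccontr)
      assume "l \<notin> {0<..<m}"
      with l have "m \<le> l" by auto
      then have "ennreal m \<le> ennreal l" by (rule ennreal_leI)
      then have "wmeasure w {x. ennreal l < g x} \<le> wmeasure w {x. ennreal m < g x}"
        unfolding wmeasure_def by (intro nn_integral_mono) (auto simp: indicator_def)
      with l m(3) show False by (auto simp: not_less[symmetric] dest: order_trans)
    qed
  qed
  then have "emeasure lborel {l. 0 < l \<and> ennreal t < wmeasure w {x. ennreal l < g x}} \<le> emeasure lborel {0<..<m}"
    by (intro emeasure_mono) auto
  then show "emeasure lborel {l. 0 < l \<and> ennreal t < wmeasure w {x. ennreal l < g x}} \<le> z"
    using m by simp
qed

text \<open>
  Write \<open>W(l)^(1/p)\<close> as an integral of \<open>t^(1/p - 1) / p\<close> over \<open>0 < t < W(l)\<close> and exchange the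
  integrals: the inner integral over \<open>l\<close> is the length of \<open>{l. t < W(l)}\<close>, at most the
  rearrangement at \<open>t\<close>.
\<close>

lemma nn_integral_ennpowr_distribution_le_lorentz_1:
  assumes p: "0 < p"
    and meas: "(\<lambda>l. wmeasure w {x. ennreal l < g x}) \<in> borel_measurable borel"
  shows "(\<integral>\<^sup>+l\<in>{0<..}. ennpowr (wmeasure w {x. ennreal l < g x}) (1 / p) \<partial>lborel) \<le> lorentz_1 p w g"
proof -
  define W where "W l = wmeasure w {x. ennreal l < g x}" for l :: real
  have [measurable]: "W \<in> borel_measurable borel" using meas unfolding W_def .
  define k where "k t = ennreal (t powr (1 / p - 1))" for t
  have [measurable]: "k \<in> borel_measurable borel" unfolding k_def by measurable
  have k: "ennreal (t powr (1 / p - 1) / p) = ennreal (1 / p) * k t" for t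
    using p by (simp add: k_def ennreal_mult[symmetric])
  have "(\<integral>\<^sup>+l\<in>{0<..}. ennpowr (W l) (1 / p) \<partial>lborel)
      = (\<integral>\<^sup>+l. (\<integral>\<^sup>+t. ennreal (1 / p) * (if 0 < l \<and> 0 < t \<and> ennreal t < W l then k t else 0) \<partial>lborel) \<partial>lborel)"
    using p by (intro nn_integral_cong)
      (auto simp: nn_integral_superlevel_eq_ennpowr[symmetric] k indicator_def intro!: nn_integral_cong)
  also have "\<dots> = ennreal (1 / p) *
      (\<integral>\<^sup>+l. (\<integral>\<^sup>+t. (if 0 < l \<and> 0 < t \<and> ennreal t < W l then k t else 0) \<partial>lborel) \<partial>lborel)"
    by (simp add: nn_integral_cmult)
  also have "(\<integral>\<^sup>+l. (\<integral>\<^sup>+t. (if 0 < l \<and> 0 < t \<and> ennreal t < W l then k t else 0) \<partial>lborel) \<partial>lborel)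
      = (\<integral>\<^sup>+t. (\<integral>\<^sup>+l. (if 0 < l \<and> 0 < t \<and> ennreal t < W l then k t else 0) \<partial>lborel) \<partial>lborel)"
    by (intro lborel_pair.Fubini'[symmetric]) measurable
  also have "\<dots> \<le> (\<integral>\<^sup>+t\<in>{0<..}. ennreal (t powr (1 / p)) * decreasing_rearrangement w g t / ennreal t \<partial>lborel)"
  proof (intro nn_integral_mono)
    fix t :: real
    show "(\<integral>\<^sup>+l. (if 0 < l \<and> 0 < t \<and> ennreal t < W l then k t else 0) \<partial>lborel)
       \<le> ennreal (t powr (1 / p)) * decreasing_rearrangement w g t / ennreal t * indicator {0<..} t"
    proof (cases "0 < t")
      case True
      have "(\<integral>\<^sup>+l. (if 0 < l \<and> 0 < t \<and> ennreal t < W l then k t else 0) \<partial>lborel)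
         = (\<integral>\<^sup>+l. k t * indicator {l. 0 < l \<and> ennreal t < W l} l \<partial>lborel)"
        using True by (intro nn_integral_cong) (auto simp: indicator_def)
      also have "\<dots> = k t * emeasure lborel {l. 0 < l \<and> ennreal t < W l}"
        by (intro nn_integral_cmult_indicator) measurable
      also have "\<dots> \<le> k t * decreasing_rearrangement w g t"
        unfolding W_def using True
        by (intro mult_left_mono emeasure_superlevel_le_decreasing_rearrangement) auto
      also have "k t * decreasing_rearrangement w g t
          = ennreal (t powr (1 / p)) / ennreal t * decreasing_rearrangement w g t"
        unfolding k_def using True by (subst divide_ennreal) (auto simp: powr_diff)
      finally show ?thesis
        using True by (simp add: divide_ennreal_def mult_ac)
    qed simp
  qed
  finally show ?thesis
    unfolding W_def lorentz_1_def nn_integral_completion by (simp add: mult_left_mono)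
qed

lemma measurable_superlevel_Int:
  fixes M :: "real measure" and G :: "real \<Rightarrow> ennreal"
  assumes sets: "sets M = sets borel" and fin: "\<And>R. emeasure M {..R} < top"
    and G: "G \<in> borel_measurable borel" and J: "J \<in> sets borel"
  shows "(\<lambda>l. emeasure M ({t. ennreal l < G t} \<inter> J)) \<in> borel_measurable borel"
proof -
  have sp: "space M = UNIV" using sets_eq_imp_space_eq[OF sets] by simp
  have "sigma_finite_measure M"
  proof
    show "\<exists>A. countable A \<and> A \<subseteq> sets M \<and> \<Union>A = space M \<and> (\<forall>a\<in>A. emeasure M a \<noteq> \<infinity>)"
      using fin by (intro exI[of _ "range (\<lambda>k::nat. {..real k})"])
        (auto simp: sets sp less_top intro: real_arch_simple)
  qed
  then have "(\<lambda>l. emeasure M ({t\<in>space M. ennreal l < G t} \<inter> J)) \<in> borel_measurable borel"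
    using G J sets by (intro measurable_superlevel_emeasure) (simp_all cong: measurable_cong_sets)
  then show ?thesis by (simp add: sp)
qed

section \<open>From a large average to a shell\<close>

text \<open>
  Here \<open>M\<close> stands for the measure of radii induced by the weight. Level by level, the shell
  estimate and the \<open>A\<^sub>1\<close> condition give \<open>\<theta>^n \<mu>(I) \<le> C \<mu>(E l \<inter> I)\<close> for the fraction \<open>\<theta>\<close> of the segment
  on which the function exceeds \<open>l\<close>. Taking roots and integrating over \<open>l\<close> bounds the average
  itself.
\<close>

lemma average_le_shell_averages:
  fixes M :: "real measure" and G :: "real \<Rightarrow> ennreal"
  assumes sets[measurable_cong]: "sets M = sets borel"
    and G[measurable]: "G \<in> borel_measurable borel"
    and n: "2 \<le> n" and C: "0 < C"
    and h: "0 \<le> h" and \<alpha>: "0 \<le> \<alpha>" "\<alpha> < \<beta>"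
  defines "I \<equiv> {sqrt (h\<^sup>2 + \<alpha>\<^sup>2)..sqrt (h\<^sup>2 + \<beta>\<^sup>2)}"
  assumes fin0: "\<And>R. emeasure M {..R} < top"
    and A1: "\<And>E. E \<in> sets borel \<Longrightarrow> emeasure M I * (\<integral>\<^sup>+t\<in>E \<inter> I. ennreal (t ^ (n - 1)) \<partial>lborel)
      \<le> ennreal C * emeasure M (E \<inter> I) * (\<integral>\<^sup>+t\<in>I. ennreal (t ^ (n - 1)) \<partial>lborel)"
  shows "(\<integral>\<^sup>+s\<in>{\<alpha>..\<beta>}. G (sqrt (h\<^sup>2 + s\<^sup>2)) \<partial>lborel) / ennreal (\<beta> - \<alpha>) * ennreal (measure M I powr (1 / n))
    \<le> ennreal (C powr (1 / n)) * (\<integral>\<^sup>+l\<in>{0<..}. ennreal (measure M ({t. ennreal l < G t} \<inter> I) powr (1 / n)) \<partial>lborel)"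
proof -
  define g where "g s = sqrt (h\<^sup>2 + s\<^sup>2)" for s
  define E where "E l = {t. ennreal l < G t}" for l :: real
  define m where "m l = measure lborel ({\<alpha>..\<beta>} \<inter> {s. g s \<in> E l})" for l
  define \<nu> where "\<nu> S = (\<integral>\<^sup>+t\<in>S. ennreal (t ^ (n - 1)) \<partial>lborel)" for S
  have [measurable]: "g \<in> borel_measurable borel" unfolding g_def by measurable
  have E[measurable]: "E l \<in> sets borel" for l unfolding E_def by measurable
  have [measurable]: "I \<in> sets borel" by (simp add: I_def)
  have fin: "emeasure M I < top"
    using emeasure_mono[of I "{..sqrt (h\<^sup>2 + \<beta>\<^sup>2)}" M] fin0 sets
    by (auto simp: I_def intro: order_le_less_trans)
  have g0: "0 \<le> g s" for s by (simp add: g_def)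
  have g_less: "g \<alpha> < g \<beta>" using \<alpha> by (simp add: g_def power_strict_mono)
  have I: "I = {g \<alpha>..g \<beta>}" by (simp add: I_def g_def)
  have "\<nu> I = ennreal (g \<beta> ^ n / n - g \<alpha> ^ n / n)"
    unfolding \<nu>_def I using g_less g0[of \<alpha>] n
    by (intro nn_integral_FTC_Icc[where F="\<lambda>t. t ^ n / n"]) (auto intro!: derivative_eq_intros)
  moreover have "g \<alpha> ^ n < g \<beta> ^ n" using g_less g0 n by (intro power_strict_mono) auto
  ultimately have \<nu>I: "0 < \<nu> I" "\<nu> I < top" using n by (auto simp: divide_simps)
  have level: "m l / (\<beta> - \<alpha>) * measure M I powr (1 / n) \<le> C powr (1 / n) * measure M (E l \<inter> I) powr (1 / n)" for l
  proof -
    define b where "b = m l / (\<beta> - \<alpha>)"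
    have b: "0 \<le> b" using \<alpha> by (simp add: b_def m_def)
    have fin': "emeasure M (E l \<inter> I) < top"
      using emeasure_mono[of "E l \<inter> I" I M] fin sets by (auto intro: order_le_less_trans)
    have "ennreal (b ^ n) * \<nu> I \<le> \<nu> (E l \<inter> I)"
      using line_fraction_le_shell_fraction[OF E h \<alpha> n, of l]
      by (simp add: b_def m_def g_def \<nu>_def I_def)
    then have "emeasure M I * (ennreal (b ^ n) * \<nu> I) \<le> emeasure M I * \<nu> (E l \<inter> I)"
      by (rule mult_left_mono) simp
    also have "\<dots> \<le> ennreal C * emeasure M (E l \<inter> I) * \<nu> I"
      using A1[OF E] unfolding \<nu>_def .
    finally have "\<nu> I * (emeasure M I * ennreal (b ^ n)) \<le> \<nu> I * (ennreal C * emeasure M (E l \<inter> I))"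
      by (simp add: ac_simps)
    then have "emeasure M I * ennreal (b ^ n) \<le> ennreal C * emeasure M (E l \<inter> I)"
      using \<nu>I by (subst (asm) ennreal_mult_le_mult_iff) auto
    then have "ennreal (measure M I * b ^ n) \<le> ennreal (C * measure M (E l \<inter> I))"
      using fin fin' b C by (simp add: emeasure_eq_ennreal_measure ennreal_mult)
    then have "measure M I * b ^ n \<le> C * measure M (E l \<inter> I)"
      using C by (subst (asm) ennreal_le_iff) auto
    then have "(measure M I * b ^ n) powr (1 / n) \<le> (C * measure M (E l \<inter> I)) powr (1 / n)"
      using b by (intro powr_mono2) auto
    moreover have "(b ^ n) powr (1 / n) = b"
      using b n by (cases "b = 0") (auto simp: powr_realpow[symmetric] powr_powr)
    ultimately show ?thesis
      using b C by (simp add: powr_mult b_def[symmetric] mult.commute)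
  qed
  have meas: "(\<lambda>l. emeasure lborel ({s\<in>space lborel. ennreal l < G (g s)} \<inter> {\<alpha>..\<beta>})) \<in> borel_measurable borel"
    by (intro measurable_superlevel_emeasure lborel.sigma_finite_measure_axioms) auto
  have em: "emeasure lborel ({s\<in>space lborel. ennreal l < G (g s)} \<inter> {\<alpha>..\<beta>}) = ennreal (m l)" for l
  proof -
    have "{s\<in>space lborel. ennreal l < G (g s)} \<inter> {\<alpha>..\<beta>} = {\<alpha>..\<beta>} \<inter> {s. g s \<in> E l}" by (auto simp: E_def)
    moreover have "emeasure lborel ({\<alpha>..\<beta>} \<inter> {s. g s \<in> E l}) \<le> emeasure lborel {\<alpha>..\<beta>}"
      by (intro emeasure_mono) auto
    ultimately show ?thesis
      using \<alpha> by (auto simp: m_def intro!: emeasure_eq_ennreal_measure simp: top_unique)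
  qed
  have [measurable]: "(\<lambda>l. ennreal (m l)) \<in> borel_measurable borel" using meas unfolding em .
  have cake: "(\<integral>\<^sup>+s\<in>{\<alpha>..\<beta>}. G (g s) \<partial>lborel) = (\<integral>\<^sup>+l\<in>{0<..}. ennreal (m l) \<partial>lborel)"
    unfolding em[symmetric] by (intro nn_integral_layer_cake lborel.sigma_finite_measure_axioms) auto
  let ?d = "ennreal (measure M I powr (1 / n) / (\<beta> - \<alpha>))"
  have "(\<integral>\<^sup>+s\<in>{\<alpha>..\<beta>}. G (g s) \<partial>lborel) / ennreal (\<beta> - \<alpha>) * ennreal (measure M I powr (1 / n))
      = ?d * (\<integral>\<^sup>+l\<in>{0<..}. ennreal (m l) \<partial>lborel)"
    unfolding cake using \<alpha>
    by (subst divide_ennreal[symmetric]) (auto simp: divide_ennreal_def mult_ac)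
  also have "\<dots> = (\<integral>\<^sup>+l. ?d * (ennreal (m l) * indicator {0<..} l) \<partial>lborel)"
    by (rule nn_integral_cmult[symmetric]) measurable
  also have "\<dots> \<le> (\<integral>\<^sup>+l. ennreal (C powr (1 / n)) *
      (ennreal (measure M (E l \<inter> I) powr (1 / n)) * indicator {0<..} l) \<partial>lborel)"
  proof (intro nn_integral_mono)
    fix l
    have "?d * ennreal (m l) = ennreal (m l / (\<beta> - \<alpha>) * measure M I powr (1 / n))"
      using \<alpha> by (subst ennreal_mult[symmetric]) (auto simp: m_def)
    also have "\<dots> \<le> ennreal (C powr (1 / n) * measure M (E l \<inter> I) powr (1 / n))"
      by (intro ennreal_leI level)
    also have "\<dots> = ennreal (C powr (1 / n)) * ennreal (measure M (E l \<inter> I) powr (1 / n))"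
      by (simp add: ennreal_mult)
    finally show "?d * (ennreal (m l) * indicator {0<..} l)
        \<le> ennreal (C powr (1 / n)) * (ennreal (measure M (E l \<inter> I) powr (1 / n)) * indicator {0<..} l)"
      by (simp add: mult.assoc[symmetric] mult_right_mono)
  qed
  also have "\<dots> = ennreal (C powr (1 / n)) *
      (\<integral>\<^sup>+l\<in>{0<..}. ennreal (measure M (E l \<inter> I) powr (1 / n)) \<partial>lborel)"
  proof (rule nn_integral_cmult)
    have "(\<lambda>l. emeasure M (E l \<inter> I)) \<in> borel_measurable borel"
      unfolding E_def using sets fin0 by (intro measurable_superlevel_Int) auto
    then show "(\<lambda>l. ennreal (measure M (E l \<inter> I) powr (1 / n)) * indicator {0<..} l) \<in> borel_measurable lborel"
      unfolding measure_def by measurable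
  qed
  finally show ?thesis by (simp add: g_def E_def)
qed

text \<open>
  The shell is a closed interval, whereas the covering argument needs open ones. Since the
  average exceeds \<open>lam\<close> strictly and \<open>0 < \<mu>(I) < \<infinity>\<close>, the bound for \<open>I\<close> holds with strict inequality
  and survives a small enlargement of \<open>I\<close> by continuity from above. Multiplying by \<open>\<mu>(J)^(1 - 1/p)\<close>
  puts it in the form that can be summed.
\<close>

lemma weak_type_interval_of_average:
  fixes M :: "real measure" and E :: "real \<Rightarrow> real set"
  assumes sets: "sets M = sets borel" and p: "1 < p"
    and E: "\<And>l. E l \<in> sets borel"
    and E_meas: "\<And>J. J \<in> sets borel \<Longrightarrow> (\<lambda>l. emeasure M (E l \<inter> J)) \<in> borel_measurable borel"
    and fin: "\<And>R. emeasure M {..R} < top"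
    and pos: "0 < emeasure M {A..B}"
    and lam: "0 < lam" "ennreal lam < c * v"
    and shell: "v * ennreal (measure M {A..B} powr (1/p))
      \<le> d * (\<integral>\<^sup>+l\<in>{0<..}. ennreal (measure M (E l \<inter> {A..B}) powr (1/p)) \<partial>lborel)"
  obtains a b where "a < A" "B < b" 
    "ennreal lam * emeasure M {a<..<b} \<le> c * d *
       (\<integral>\<^sup>+l\<in>{0<..}. ennreal (measure M {a<..<b} powr (1 - 1/p) * measure M (E l \<inter> {a<..<b}) powr (1/p)) \<partial>lborel)"
proof -
  define J where "J k = {A - 1 / real (Suc k)<..<B + 1 / real (Suc k)}" for k
  define T where "T S = (\<integral>\<^sup>+l\<in>{0<..}. ennreal (measure M (E l \<inter> S) powr (1/p)) \<partial>lborel)" for S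
  have J[measurable]: "J k \<in> sets M" for k by (simp add: J_def sets)
  have J_fin: "emeasure M (J k) < top" for k
  proof (rule order_le_less_trans[OF emeasure_mono fin])
    show "J k \<subseteq> {..B + 1 / real (Suc k)}" by (auto simp: J_def)
  qed (simp add: sets)
  have AB_fin: "emeasure M {A..B} < top"
    by (rule order_le_less_trans[OF emeasure_mono fin[of B]]) (auto simp: sets)
  have mpos: "0 < measure M {A..B}"
    using pos AB_fin by (simp add: emeasure_eq_ennreal_measure)
  have inter: "(\<Inter>k. J k) = {A..B}"
  proof safe
    fix x assume x: "x \<in> (\<Inter>k. J k)"
    have le: "A - x \<le> 1 / real (Suc k)" "x - B \<le> 1 / real (Suc k)" for k
      using x by (auto simp: J_def dest!: spec[of _ k])
    have lim: "(\<lambda>k. 1 / real (Suc k)) \<longlonglongrightarrow> 0" by (rule LIMSEQ_Suc[OF lim_1_over_n])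
    have "A - x \<le> 0" by (rule LIMSEQ_le_const[OF lim]) (use le in blast)
    moreover have "x - B \<le> 0" by (rule LIMSEQ_le_const[OF lim]) (use le in blast)
    ultimately show "x \<in> {A..B}" by simp
  next
    fix x k assume "x \<in> {A..B}"
    then have "A \<le> x" "x \<le> B" by auto
    moreover have "0 < 1 / real (Suc k)" by simp
    ultimately show "x \<in> J k" unfolding J_def greaterThanLessThan_iff by linarith
  qed
  have dec: "decseq J"
    unfolding decseq_def
  proof (intro allI impI)
    fix i j :: nat assume "i \<le> j"
    then have "1 / real (Suc j) \<le> 1 / real (Suc i)" by (intro divide_left_mono) auto
    then show "J j \<subseteq> J i" unfolding J_def by (intro greaterThanLessThan_subseteq_greaterThanLessThan[THEN iffD2]) auto
  qed
  have "(\<lambda>k. measure M (J k)) \<longlonglongrightarrow> measure M {A..B}"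
    unfolding inter[symmetric] using J J_fin dec by (intro Lim_measure_decseq) (auto simp: less_top)
  then have "(\<lambda>k. measure M (J k) powr (1/p)) \<longlonglongrightarrow> measure M {A..B} powr (1/p)"
    using mpos by (intro tendsto_powr tendsto_const) auto
  then have "(\<lambda>k. ennreal (lam * measure M (J k) powr (1/p))) \<longlonglongrightarrow> ennreal (lam * measure M {A..B} powr (1/p))"
    by (intro tendsto_ennrealI tendsto_mult tendsto_const)
  moreover have "ennreal (lam * measure M {A..B} powr (1/p)) < c * d * T {A..B}"
  proof -
    have "ennreal (lam * measure M {A..B} powr (1/p)) = ennreal lam * ennreal (measure M {A..B} powr (1/p))"
      using lam by (simp add: ennreal_mult)
    also have "\<dots> < c * v * ennreal (measure M {A..B} powr (1/p))"
      using lam mpos by (intro ennreal_mult_strict_right_mono) auto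
    also have "\<dots> \<le> c * d * T {A..B}"
      using mult_left_mono[OF shell, of c] by (simp add: T_def mult.assoc)
    finally show ?thesis .
  qed
  ultimately have "\<forall>\<^sub>F k in sequentially. ennreal (lam * measure M (J k) powr (1/p)) < c * d * T {A..B}"
    by (rule order_tendstoD)
  then obtain k where k: "ennreal (lam * measure M (J k) powr (1/p)) < c * d * T {A..B}"
    by (auto simp: eventually_sequentially)
  have sub: "{A..B} \<subseteq> J k" using inter by auto
  have "T {A..B} \<le> T (J k)"
    unfolding T_def
  proof (intro nn_integral_mono mult_right_mono ennreal_leI powr_mono2)
    show "measure M (E l \<inter> {A..B}) \<le> measure M (E l \<inter> J k)" for l
    proof (rule measure_mono_fmeasurable)
      have "emeasure M (E l \<inter> J k) \<le> emeasure M (J k)" using J by (intro emeasure_mono) auto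
      then show "E l \<inter> J k \<in> fmeasurable M"
        using J_fin[of k] E sets J by (auto simp: fmeasurable_def intro: order_le_less_trans)
    qed (use sub E sets in auto)
  qed (use p in auto)
  with k have le: "ennreal (lam * measure M (J k) powr (1/p)) \<le> c * d * T (J k)"
    by (meson less_imp_le mult_left_mono order_trans zero_le)
  have "0 < measure M (J k)"
    using mpos measure_mono_fmeasurable[OF sub, of M] J J_fin sets by (auto simp: fmeasurable_def)
  then have split: "measure M (J k) = measure M (J k) powr (1 - 1/p) * measure M (J k) powr (1/p)"
    by (simp add: powr_add[symmetric])
  have [measurable]: "(\<lambda>l. emeasure M (E l \<inter> J k)) \<in> borel_measurable borel"
    by (intro E_meas) (simp add: J_def)
  have meas: "(\<lambda>l. ennreal (measure M (E l \<inter> J k) powr (1/p)) * indicator {0<..} l) \<in> borel_measurable lborel"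
    unfolding measure_def by measurable
  have "ennreal lam * emeasure M (J k) = ennreal lam * ennreal (measure M (J k))"
    using J_fin[of k] by (simp add: emeasure_eq_ennreal_measure)
  also have "\<dots> = ennreal (measure M (J k) powr (1 - 1/p)) * ennreal (lam * measure M (J k) powr (1/p))"
    using lam by (subst split) (simp add: ennreal_mult mult_ac)
  also have "\<dots> \<le> ennreal (measure M (J k) powr (1 - 1/p)) * (c * d * T (J k))"
    using le by (intro mult_left_mono) auto
  also have "\<dots> = c * d * (ennreal (measure M (J k) powr (1 - 1/p)) * T (J k))"
    by (simp add: mult_ac)
  also have "ennreal (measure M (J k) powr (1 - 1/p)) * T (J k) =
      (\<integral>\<^sup>+l. ennreal (measure M (J k) powr (1 - 1/p)) *
        (ennreal (measure M (E l \<inter> J k) powr (1/p)) * indicator {0<..} l) \<partial>lborel)"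
    unfolding T_def by (rule nn_integral_cmult[symmetric]) (rule meas)
  also have "\<dots> = (\<integral>\<^sup>+l\<in>{0<..}. ennreal (measure M (J k) powr (1 - 1/p) * measure M (E l \<inter> J k) powr (1/p)) \<partial>lborel)"
    by (simp add: ennreal_mult mult.assoc)
  finally show thesis unfolding J_def by (intro that) auto
qed

section \<open>The universal maximal operator on radial functions\<close>

text \<open>
  A null set of radii meets every line in a null set, also the lines through the origin: by the
  substitution \<open>t = sqrt (h\<^sup>2 + s\<^sup>2)\<close> the measure \<open>s ds\<close> of the exceptional set vanishes. Hence the
  maximal function can be computed at every point from a Borel profile.
\<close>

lemma AE_along_line:
  fixes x u :: "'a::euclidean_space"
  assumes u: "norm u = 1" and ae: "AE t in lborel. 0 \<le> t \<longrightarrow> P t"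
  shows "AE s in lborel. P (norm (x + s *\<^sub>R u))"
proof -
  obtain h c where h: "0 \<le> h" and line: "\<And>s. norm (x + s *\<^sub>R u) = sqrt (h\<^sup>2 + (s + c)\<^sup>2)"
    using norm_along_line[OF u, of x] by blast
  obtain N where N: "N \<in> null_sets lborel" "{t. \<not> (0 \<le> t \<longrightarrow> P t)} \<subseteq> N"
    using ae unfolding eventually_ae_filter by auto
  have N_borel[measurable]: "N \<in> sets borel" using N by (auto simp: null_sets_def)
  define Q where "Q s \<longleftrightarrow> sqrt (h\<^sup>2 + s\<^sup>2) \<notin> N" for s
  have Q_meas[measurable]: "Measurable.pred borel Q" unfolding Q_def by measurable
  have "AE s in lborel. 0 < s \<longrightarrow> s \<le> real k \<longrightarrow> Q s" for k
  proof (cases "k = 0")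
    case False
    \<comment> \<open>For \<open>n = 2\<close> the transformed density is \<open>s ds\<close>, which vanishes only at \<open>s = 0\<close>.\<close>
    have "(\<integral>\<^sup>+s\<in>{0..real k}. ennreal s * indicator N (sqrt (h\<^sup>2 + s\<^sup>2)) \<partial>lborel)
        = (\<integral>\<^sup>+t\<in>{sqrt (h\<^sup>2 + 0\<^sup>2)..sqrt (h\<^sup>2 + (real k)\<^sup>2)}. ennreal t * indicator N t \<partial>lborel)"
      using nn_integral_distance_substitution[of "indicator N" h 0 "real k" 2] h False by simp
    also have "\<dots> = 0"
    proof (subst nn_integral_0_iff_AE)
      show "AE t in lborel. ennreal t * indicator N t * indicator {sqrt (h\<^sup>2 + 0\<^sup>2)..sqrt (h\<^sup>2 + (real k)\<^sup>2)} t = 0"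
        using AE_not_in[OF N(1)] by eventually_elim auto
    qed measurable
    finally have "AE s in lborel. ennreal s * indicator N (sqrt (h\<^sup>2 + s\<^sup>2)) * indicator {0..real k} s = 0"
      by (subst (asm) nn_integral_0_iff_AE) measurable
    then show ?thesis
      by eventually_elim (auto simp: Q_def indicator_def split: if_splits)
  qed auto
  then have "AE s in lborel. \<forall>k::nat. 0 < s \<longrightarrow> s \<le> real k \<longrightarrow> Q s"
    by (intro AE_all_countable[THEN iffD2] allI)
  then have pos: "AE s in lborel. 0 < s \<longrightarrow> Q s"
    by eventually_elim (meson real_arch_simple)
  have pos_meas: "Measurable.pred borel (\<lambda>s. 0 < s \<longrightarrow> Q s)" by measurable
  have neg: "AE s in lborel. 0 < - s \<longrightarrow> Q (- s)"
    using AE_borel_affine[of "-1" "\<lambda>s. 0 < s \<longrightarrow> Q s" 0, OF _ pos_meas pos] by simp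
  have "AE s in lborel. Q s"
    using pos neg AE_lborel_singleton[of 0]
    by eventually_elim (auto simp: Q_def not_less intro: ccontr dest: less_le_trans)
  then have "AE s in lborel. Q (c + 1 * s)"
    using Q_meas by (intro AE_borel_affine) auto
  then show ?thesis
  proof eventually_elim
    case (elim s)
    then have "norm (x + s *\<^sub>R u) \<notin> N" by (simp add: Q_def line add.commute)
    then show ?case using N(2) norm_ge_zero by blast
  qed
qed

lemma universal_maximal_profile:
  fixes f :: "'a::euclidean_space \<Rightarrow> 'b::real_normed_vector"
  assumes f: "\<And>x. f x = f0 (norm x)"
    and ae: "AE t in lborel. 0 \<le> t \<longrightarrow> ennreal (norm (f0 t)) = G t"
  shows "universal_maximal f x =
     (SUP u\<in>sphere 0 1. SUP (a, b)\<in>{(a::real, b). a \<le> 0 \<and> 0 \<le> b \<and> a < b}.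
        (\<integral>\<^sup>+s\<in>{a..b}. G (norm (x + s *\<^sub>R u)) \<partial>lborel) / ennreal (b - a))"
  unfolding universal_maximal_def nn_integral_completion
proof (intro SUP_cong refl)
  fix u :: 'a and ab :: "real \<times> real" assume "u \<in> sphere 0 1"
  then have "norm u = 1" by simp
  from AE_along_line[OF this ae, of x]
  have "AE s in lborel. ennreal (norm (f (x + s *\<^sub>R u))) = G (norm (x + s *\<^sub>R u))"
    by (simp add: f)
  then have "(\<integral>\<^sup>+s\<in>{a..b}. ennreal (norm (f (x + s *\<^sub>R u))) \<partial>lborel)
      = (\<integral>\<^sup>+s\<in>{a..b}. G (norm (x + s *\<^sub>R u)) \<partial>lborel)" for a b
    by (intro nn_integral_cong_AE) (auto elim: eventually_mono)
  then show "(case ab of (a, b) \<Rightarrow> (\<integral>\<^sup>+s\<in>{a..b}. ennreal (norm (f (x + s *\<^sub>R u))) \<partial>lborel) / ennreal (b - a))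
    = (case ab of (a, b) \<Rightarrow> (\<integral>\<^sup>+s\<in>{a..b}. G (norm (x + s *\<^sub>R u)) \<partial>lborel) / ennreal (b - a))"
    by (simp split: prod.split)
qed

text \<open>
  The open set \<open>V\<close> of radii is the union of all intervals satisfying the bound that can be
  summed; every point with large maximal function produces one such interval around its norm.
\<close>

lemma radial_weak_type:
  fixes f :: "'a::euclidean_space \<Rightarrow> 'b::real_normed_vector"
    and M :: "real measure" and G :: "real \<Rightarrow> ennreal"
  assumes f: "\<And>x. f x = f0 (norm x)"
    and G: "G \<in> borel_measurable borel"
    and ae: "AE t in lborel. 0 \<le> t \<longrightarrow> ennreal (norm (f0 t)) = G t"
    and sets: "sets M = sets borel" and n: "2 \<le> n" and C: "0 < C"
    and fin: "\<And>R. emeasure M {..R} < top"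
    and pos: "\<And>A B. 0 \<le> A \<Longrightarrow> A < B \<Longrightarrow> 0 < emeasure M {A..B}"
    and A1: "\<And>A B E. 0 \<le> A \<Longrightarrow> A < B \<Longrightarrow> E \<in> sets borel \<Longrightarrow>
      emeasure M {A..B} * (\<integral>\<^sup>+t\<in>E \<inter> {A..B}. ennreal (t ^ (n - 1)) \<partial>lborel)
      \<le> ennreal C * emeasure M (E \<inter> {A..B}) * (\<integral>\<^sup>+t\<in>{A..B}. ennreal (t ^ (n - 1)) \<partial>lborel)"
    and lam: "0 < lam"
  obtains V where "open V" "{x. universal_maximal f x > ennreal lam} \<subseteq> {x. norm x \<in> V}"
    "ennreal lam * ennpowr (emeasure M V) (1 / n) \<le> ennreal (2 * C powr (1 / n) * 2 powr (1 / n)) *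
      (\<integral>\<^sup>+l\<in>{0<..}. ennpowr (emeasure M {t. ennreal l < G t}) (1 / n) \<partial>lborel)"
proof -
  define E where "E l = {t. ennreal l < G t}" for l
  have E: "E l \<in> sets borel" for l unfolding E_def using G by measurable
  have E_meas: "(\<lambda>l. emeasure M (E l \<inter> J)) \<in> borel_measurable borel" if "J \<in> sets borel" for J
    unfolding E_def by (rule measurable_superlevel_Int[OF sets fin G that])
  define F where "F = {J. (\<exists>a b. J = {a<..<b}) \<and> ennreal lam * emeasure M J \<le> ennreal (2 * C powr (1 / n)) *
       (\<integral>\<^sup>+l\<in>{0<..}. ennreal (measure M J powr (1 - 1/n) * measure M (E l \<inter> J) powr (1/n)) \<partial>lborel)}"
  have cover: "norm x \<in> \<Union>F" if x: "universal_maximal f x > ennreal lam" for x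
  proof -
    from x obtain u a b where u: "norm u = 1" and ab: "a \<le> 0" "0 \<le> b" "a < b"
      and avg: "ennreal lam < (\<integral>\<^sup>+s\<in>{a..b}. G (norm (x + s *\<^sub>R u)) \<partial>lborel) / ennreal (b - a)"
      unfolding universal_maximal_profile[OF f ae] by (auto simp: less_SUP_iff)
    obtain h \<alpha> \<beta> where h: "0 \<le> h" and \<alpha>: "0 \<le> \<alpha>" "\<alpha> < \<beta>"
      and nx: "sqrt (h\<^sup>2 + \<alpha>\<^sup>2) \<le> norm x" "norm x \<le> sqrt (h\<^sup>2 + \<beta>\<^sup>2)"
      and red: "(\<integral>\<^sup>+s\<in>{a..b}. G (norm (x + s *\<^sub>R u)) \<partial>lborel) / ennreal (b - a)
      \<le> 2 * ((\<integral>\<^sup>+s\<in>{\<alpha>..\<beta>}. G (sqrt (h\<^sup>2 + s\<^sup>2)) \<partial>lborel) / ennreal (\<beta> - \<alpha>))"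
      using line_average_reduction[OF G u ab, of x] by blast
    let ?A = "sqrt (h\<^sup>2 + \<alpha>\<^sup>2)" and ?B = "sqrt (h\<^sup>2 + \<beta>\<^sup>2)"
    have AB: "0 \<le> ?A" "?A < ?B" using \<alpha> by (auto simp: power_strict_mono)
    have shell: "(\<integral>\<^sup>+s\<in>{\<alpha>..\<beta>}. G (sqrt (h\<^sup>2 + s\<^sup>2)) \<partial>lborel) / ennreal (\<beta> - \<alpha>) * ennreal (measure M {?A..?B} powr (1 / n))
      \<le> ennreal (C powr (1 / n)) * (\<integral>\<^sup>+l\<in>{0<..}. ennreal (measure M (E l \<inter> {?A..?B}) powr (1 / n)) \<partial>lborel)"
      unfolding E_def by (rule average_le_shell_averages[OF sets G n C h \<alpha> fin A1[OF AB]])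
    have p: "1 < real n" using n by simp
    obtain a' b' where J: "a' < ?A" "?B < b'"
      and bd: "ennreal lam * emeasure M {a'<..<b'} \<le> 2 * ennreal (C powr (1 / n)) *
       (\<integral>\<^sup>+l\<in>{0<..}. ennreal (measure M {a'<..<b'} powr (1 - 1/n) * measure M (E l \<inter> {a'<..<b'}) powr (1/n)) \<partial>lborel)"
      by (rule weak_type_interval_of_average[OF sets p E E_meas fin pos[OF AB] lam less_le_trans[OF avg red] shell])
    have "2 * ennreal (C powr (1 / n)) = ennreal (2 * C powr (1 / n))" by (simp add: ennreal_mult)
    then have "{a'<..<b'} \<in> F" unfolding F_def using bd by auto
    moreover have "norm x \<in> {a'<..<b'}" using J nx by auto
    ultimately show ?thesis by blast
  qed
  have F_fin: "emeasure M J < top" if "J \<in> F" for J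
  proof -
    obtain a b where J: "J = {a<..<b}" using \<open>J \<in> F\<close> unfolding F_def by blast
    show ?thesis by (rule order_le_less_trans[OF emeasure_mono fin[of b]]) (auto simp: J sets)
  qed
  have "ennreal lam * ennpowr (emeasure M (\<Union>F)) (1/n)
     \<le> ennreal (2 * C powr (1 / n) * 2 powr (1/n)) * (\<integral>\<^sup>+l\<in>{0<..}. ennpowr (emeasure M (E l)) (1/n) \<partial>lborel)"
    by (rule weak_type_interval_family[OF sets _ lam _ E E_meas])
      (use n F_fin in \<open>auto simp: F_def\<close>)
  moreover have "open (\<Union>F)" by (intro open_Union) (auto simp: F_def)
  ultimately show thesis using cover by (intro that[of "\<Union>F"]) (auto simp: E_def)
qed

section \<open>Radial weights of class \<open>A\<^sub>1\<close>\<close>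

text \<open>
  Local integrability on each ball gives measurability of the truncations, which converge
  pointwise.
\<close>

lemma weight_measurable:
  fixes w :: "'a::euclidean_space \<Rightarrow> real"
  assumes "weight w"
  shows "w \<in> borel_measurable lebesgue"
proof (rule borel_measurable_LIMSEQ_real)
  fix x :: 'a
  obtain k :: nat where k: "norm x \<le> real k" using real_arch_simple by blast
  have "(\<lambda>i. indicator (cball 0 (real i)) x *\<^sub>R w x) \<longlonglongrightarrow> w x \<longleftrightarrow> (\<lambda>i::nat. w x) \<longlonglongrightarrow> w x"
  proof (rule filterlim_cong[OF refl refl])
    show "\<forall>\<^sub>F i in sequentially. indicator (cball 0 (real i)) x *\<^sub>R w x = w x"
      using eventually_ge_at_top[of k] by eventually_elim (use k in \<open>auto simp: indicator_def\<close>)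
  qed
  then show "(\<lambda>i. indicator (cball 0 (real i)) x *\<^sub>R w x) \<longlonglongrightarrow> w x" by simp
next
  show "(\<lambda>x. indicator (cball 0 (real i)) x *\<^sub>R w x) \<in> borel_measurable lebesgue" for i :: nat
    using assms unfolding weight_def set_integrable_def
    by (intro borel_measurable_integrable) auto
qed

text \<open>
  If \<open>w\<close> has mass somewhere, then its maximal function is positive everywhere, and \<open>C w\<close> dominates
  it.
\<close>

lemma A1_weight_zero_or_positive:
  fixes w :: "'a::euclidean_space \<Rightarrow> real"
  assumes "A1_weight w"
  shows "(AE x in lborel. w x = 0) \<or> (AE x in lborel. 0 < w x)"
proof (cases "AE x in lborel. w x = 0")
  case False
  from assms obtain C where w: "weight w" and C: "0 < C"
    and HL: "AE x in lebesgue. HL_maximal w x \<le> ennreal (C * w x)"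
    unfolding A1_weight_def by blast
  have [measurable]: "w \<in> borel_measurable lebesgue" using w by (rule weight_measurable)
  obtain k :: nat where k: "(\<integral>\<^sup>+y\<in>cball 0 (real k). ennreal \<bar>w y\<bar> \<partial>lebesgue) \<noteq> 0"
  proof (rule ccontr)
    assume "\<not> thesis"
    then have 0: "(\<integral>\<^sup>+y\<in>cball 0 (real k). ennreal \<bar>w y\<bar> \<partial>lebesgue) = 0" for k :: nat using that by blast
    have "AE y in lebesgue. y \<in> cball 0 (real k) \<longrightarrow> w y = 0" for k :: nat
    proof -
      have "(\<lambda>y. ennreal \<bar>w y\<bar> * indicator (cball 0 (real k)) y) \<in> borel_measurable lebesgue"
        by (intro borel_measurable_times_ennreal borel_measurable_indicator) auto
      then have "AE y in lebesgue. ennreal \<bar>w y\<bar> * indicator (cball 0 (real k)) y = 0"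
        using 0[of k] by (subst (asm) nn_integral_0_iff_AE) auto
      then show ?thesis by eventually_elim (auto simp: indicator_def split: if_splits)
    qed
    then have "AE y in lebesgue. \<forall>k::nat. y \<in> cball 0 (real k) \<longrightarrow> w y = 0"
      by (intro AE_all_countable[THEN iffD2] allI)
    then have "AE y in lebesgue. w y = 0"
      by eventually_elim (auto intro: real_arch_simple dest: spec)
    with False show False by (simp add: AE_completion_iff)
  qed
  have HL_pos: "0 < HL_maximal w x" for x
  proof -
    define r where "r = real k + norm x + 1"
    have r: "0 < r" by (simp add: r_def add_nonneg_pos)
    \<comment> \<open>A ball around \<open>x\<close> that contains the mass found near the origin.\<close>
    have "cball (0::'a) (real k) \<subseteq> ball x r"
    proof
      fix y :: 'a assume "y \<in> cball 0 (real k)"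
      then show "y \<in> ball x r" using norm_triangle_ineq4[of x y] by (auto simp: r_def dist_norm)
    qed
    then have "(\<integral>\<^sup>+y\<in>cball 0 (real k). ennreal \<bar>w y\<bar> \<partial>lebesgue) \<le> (\<integral>\<^sup>+y\<in>ball x r. ennreal \<bar>w y\<bar> \<partial>lebesgue)"
      by (intro nn_integral_mono) (auto simp: indicator_def)
    then have "0 < (\<integral>\<^sup>+y\<in>ball x r. ennreal \<bar>w y\<bar> \<partial>lebesgue)" using k by (auto simp: zero_less_iff_neq_zero)
    then have "0 < (\<integral>\<^sup>+y\<in>ball x r. ennreal \<bar>w y\<bar> \<partial>lebesgue) / emeasure lebesgue (ball x r)"
      using emeasure_bounded_finite[of "ball x r"] by (simp add: ennreal_zero_less_divide less_top)
    also have "\<dots> \<le> HL_maximal w x" unfolding HL_maximal_def using r by (intro SUP_upper) auto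
    finally show ?thesis .
  qed
  from HL have "AE x in lebesgue. 0 < w x"
  proof eventually_elim
    case (elim x)
    have "0 < ennreal (C * w x)" by (rule less_le_trans[OF HL_pos elim])
    then show ?case using C by (simp add: zero_less_mult_iff)
  qed
  then show ?thesis by (simp add: AE_completion_iff)
qed simp

text \<open>
  The condition on the constant inside the definition of \<^const>\<open>radial_A1_const\<close>, with \<open>C\<close> in \<open>[0, \<infinity>]\<close> so
  that it can be stated for the infimum.
\<close>

definition A1_admissible :: "nat \<Rightarrow> (real \<Rightarrow> real) \<Rightarrow> ennreal \<Rightarrow> bool" where
  "A1_admissible n w0 C \<longleftrightarrow>
     (\<forall>I. is_interval I \<and> bounded I \<and> I \<subseteq> {0..} \<and> 0 < emeasure lebesgue I \<longrightarrow>
        (\<integral>\<^sup>+t\<in>I. ennreal (w0 t * t ^ (n - 1)) \<partial>lebesgue) / (\<integral>\<^sup>+t\<in>I. ennreal (t ^ (n - 1)) \<partial>lebesgue)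
          \<le> C * ess_inf_on I (\<lambda>t. ennreal (w0 t)))"

lemma radial_A1_const_eq_Inf:
  "radial_A1_const n w0 = Inf {ennreal C | C. 0 < C \<and> A1_admissible n w0 (ennreal C)}"
  unfolding radial_A1_const_def A1_admissible_def ..

text \<open>
  The defining inequality is closed in \<open>C\<close>, so the infimum is attained. A positive infimum is
  needed when the essential infimum of \<open>w\<^sub>0\<close> on \<open>I\<close> is infinite, because \<open>0 * \<infinity> = 0\<close>.
\<close>

lemma A1_admissible_radial_A1_const:
  assumes pos: "0 < radial_A1_const n w0" and fin: "radial_A1_const n w0 < top"
  shows "A1_admissible n w0 (radial_A1_const n w0)"
  unfolding A1_admissible_def
proof (intro allI impI)
  fix I :: "real set"
  assume I: "is_interval I \<and> bounded I \<and> I \<subseteq> {0..} \<and> 0 < emeasure lebesgue I"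
  define X where "X = (\<integral>\<^sup>+t\<in>I. ennreal (w0 t * t ^ (n - 1)) \<partial>lebesgue) / (\<integral>\<^sup>+t\<in>I. ennreal (t ^ (n - 1)) \<partial>lebesgue)"
  define e where "e = ess_inf_on I (\<lambda>t. ennreal (w0 t))"
  have le: "X \<le> ennreal C * e" if "0 < C" "A1_admissible n w0 (ennreal C)" for C
    using that I unfolding A1_admissible_def X_def e_def by blast
  have "X \<le> radial_A1_const n w0 * e"
  proof (cases "e = 0 \<or> e = top")
    case True
    have "\<exists>C. 0 < C \<and> A1_admissible n w0 (ennreal C)"
    proof (rule ccontr)
      assume "\<not> ?thesis"
      then have "radial_A1_const n w0 = top" unfolding radial_A1_const_eq_Inf by auto
      with fin show False by simp
    qed
    then show ?thesis using True le pos by (auto simp: ennreal_mult_top)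
  next
    case False
    have "X / e \<le> radial_A1_const n w0"
      unfolding radial_A1_const_eq_Inf
    proof (rule Inf_greatest)
      fix z assume "z \<in> {ennreal C | C. 0 < C \<and> A1_admissible n w0 (ennreal C)}"
      then obtain C where "z = ennreal C" "0 < C" "A1_admissible n w0 (ennreal C)" by auto
      then show "X / e \<le> z" using le[of C] False
        by (intro divide_le_posI_ennreal) (auto simp: zero_less_iff_neq_zero mult.commute)
    qed
    then have "e * (X / e) \<le> e * radial_A1_const n w0" by (rule mult_left_mono) simp
    moreover have "e * (X / e) = X"
      using False by (simp add: ennreal_times_divide mult.commute[of e] mult_divide_eq_ennreal)
    ultimately show ?thesis by (simp add: mult.commute)
  qed
  then show "(\<integral>\<^sup>+t\<in>I. ennreal (w0 t * t ^ (n - 1)) \<partial>lebesgue) / (\<integral>\<^sup>+t\<in>I. ennreal (t ^ (n - 1)) \<partial>lebesgue)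
      \<le> radial_A1_const n w0 * ess_inf_on I (\<lambda>t. ennreal (w0 t))"
    by (simp add: X_def e_def)
qed

text \<open>
  The image under the norm of the measure \<open>W(|x|) dx\<close> on \<open>\<real>^n\<close>, as a measure on the radii.
\<close>

definition radial_measure :: "nat \<Rightarrow> (real \<Rightarrow> ennreal) \<Rightarrow> real measure" where
  "radial_measure n W =
     density lborel (\<lambda>t. ennreal (radial_factor n) * (ennreal (t ^ (n - 1)) * indicator {0..} t) * W t)"

lemma sets_radial_measure [simp]: "sets (radial_measure n W) = sets borel"
  by (simp add: radial_measure_def)

lemma emeasure_radial_measure:
  assumes W[measurable]: "W \<in> borel_measurable borel" and E[measurable]: "E \<in> sets borel"
  shows "emeasure (radial_measure n W) E =
    ennreal (radial_factor n) * (\<integral>\<^sup>+t\<in>{0..}. ennreal (t ^ (n - 1)) * (W t * indicator E t) \<partial>lborel)"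
proof -
  have "emeasure (radial_measure n W) E = (\<integral>\<^sup>+t. ennreal (radial_factor n) *
      (ennreal (t ^ (n - 1)) * (W t * indicator E t) * indicator {0..} t) \<partial>lborel)"
    unfolding radial_measure_def
    by (subst emeasure_density) (auto simp: mult_ac intro!: nn_integral_cong)
  then show ?thesis by (simp add: nn_integral_cmult)
qed

lemma wmeasure_radial:
  fixes w :: "'a::euclidean_space \<Rightarrow> real"
  assumes w: "\<And>x. w x = w0 (norm x)"
    and W[measurable]: "W \<in> borel_measurable borel"
    and ae: "AE t in lborel. 0 \<le> t \<longrightarrow> ennreal (w0 t) = W t"
    and E[measurable]: "E \<in> sets borel"
    and S: "AE t in lborel. 0 \<le> t \<longrightarrow> (t \<in> S \<longleftrightarrow> t \<in> E)"
  shows "wmeasure w {x. norm x \<in> S} = emeasure (radial_measure DIM('a) W) E"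
proof -
  have "wmeasure w {x. norm x \<in> S} = (\<integral>\<^sup>+x. W (norm x) * indicator E (norm x) \<partial>(lborel :: 'a measure))"
    unfolding wmeasure_def nn_integral_completion
  proof (rule nn_integral_cong_AE)
    show "AE x in (lborel :: 'a measure). ennreal (w x) * indicator {x. norm x \<in> S} x = W (norm x) * indicator E (norm x)"
      using AE_norm_of_profile[OF ae] AE_norm_of_profile[OF S]
      by eventually_elim (auto simp: w indicator_def)
  qed
  also have "\<dots> = emeasure (radial_measure DIM('a) W) E"
    by (subst nn_integral_radial) (auto simp: emeasure_radial_measure)
  finally show ?thesis .
qed

lemma ess_inf_on_mult_le:
  fixes h :: "real \<Rightarrow> ennreal"
  assumes h: "AE t in lborel. t \<in> I \<longrightarrow> h t = W t"
    and S: "S \<subseteq> I" and [measurable]: "S \<in> sets borel" "v \<in> borel_measurable borel"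
  shows "ess_inf_on I h * (\<integral>\<^sup>+t\<in>S. v t \<partial>lborel) \<le> (\<integral>\<^sup>+t\<in>S. v t * W t \<partial>lborel)"
proof -
  have "c * (\<integral>\<^sup>+t\<in>S. v t \<partial>lborel) \<le> (\<integral>\<^sup>+t\<in>S. v t * W t \<partial>lborel)"
    if "AE t in lebesgue. t \<in> I \<longrightarrow> c \<le> h t" for c
  proof -
    have "c * (\<integral>\<^sup>+t\<in>S. v t \<partial>lborel) = (\<integral>\<^sup>+t. c * (v t * indicator S t) \<partial>lborel)"
      by (rule nn_integral_cmult[symmetric]) measurable
    also have "\<dots> \<le> (\<integral>\<^sup>+t\<in>S. v t * W t \<partial>lborel)"
    proof (rule nn_integral_mono_AE)
      have "AE t in lborel. t \<in> I \<longrightarrow> c \<le> h t" using that by (simp add: AE_completion_iff)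
      with h show "AE t in lborel. c * (v t * indicator S t) \<le> v t * W t * indicator S t"
      proof eventually_elim
        case (elim t)
        then show ?case using S by (auto simp: indicator_def mult.commute[of c] intro!: mult_left_mono)
      qed
    qed
    finally show ?thesis .
  qed
  then have "(SUP c\<in>{c. AE t in lebesgue. t \<in> I \<longrightarrow> c \<le> h t}. c * (\<integral>\<^sup>+t\<in>S. v t \<partial>lborel))
      \<le> (\<integral>\<^sup>+t\<in>S. v t * W t \<partial>lborel)"
    by (intro SUP_least) auto
  then show ?thesis
    unfolding ess_inf_on_def SUP_mult_right_ennreal[symmetric] by simp
qed

text \<open>
  Almost everywhere on \<open>I = [A, B]\<close> the weight is at least its essential infimum \<open>e\<close>, so \<open>E \<inter> I\<close> has
  weighted mass at least \<open>e\<close> times its unweighted mass; the \<open>A\<^sub>1\<close> condition bounds the weighted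
  average over \<open>I\<close> by \<open>C e\<close>. Cross-multiplying eliminates \<open>e\<close> and avoids division by a possibly
  vanishing mass.
\<close>

lemma A1_admissible_radial_measure:
  assumes n: "1 \<le> n" and adm: "A1_admissible n w0 C"
    and W[measurable]: "W \<in> borel_measurable borel"
    and ae: "AE t in lborel. 0 \<le> t \<longrightarrow> ennreal (w0 t) = W t"
    and A: "0 \<le> A" "A < B" and E[measurable]: "E \<in> sets borel"
  shows "emeasure (radial_measure n W) {A..B} * (\<integral>\<^sup>+t\<in>E \<inter> {A..B}. ennreal (t ^ (n - 1)) \<partial>lborel)
      \<le> C * emeasure (radial_measure n W) (E \<inter> {A..B}) * (\<integral>\<^sup>+t\<in>{A..B}. ennreal (t ^ (n - 1)) \<partial>lborel)"
proof -
  define \<nu> where "\<nu> S = (\<integral>\<^sup>+t\<in>S. ennreal (t ^ (n - 1)) \<partial>lborel)" for S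
  define \<omega> where "\<omega> S = (\<integral>\<^sup>+t\<in>S. ennreal (t ^ (n - 1)) * W t \<partial>lborel)" for S
  define e where "e = ess_inf_on {A..B} (\<lambda>t. ennreal (w0 t))"
  let ?k = "ennreal (radial_factor n)"
  have M: "emeasure (radial_measure n W) S = ?k * \<omega> S" if "S \<in> sets borel" "S \<subseteq> {0..}" for S
  proof -
    have "(\<integral>\<^sup>+t\<in>{0..}. ennreal (t ^ (n - 1)) * (W t * indicator S t) \<partial>lborel) = \<omega> S"
      unfolding \<omega>_def by (rule nn_integral_cong) (use that(2) in \<open>auto simp: indicator_def\<close>)
    then show ?thesis by (simp add: emeasure_radial_measure[OF W that(1)])
  qed
  have "\<nu> {A..B} = ennreal (B ^ n / n - A ^ n / n)"
    unfolding \<nu>_def using A n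
    by (intro nn_integral_FTC_Icc[where F="\<lambda>t. t ^ n / n"]) (auto intro!: derivative_eq_intros)
  moreover have "A ^ n < B ^ n" using A n by (intro power_strict_mono) auto
  ultimately have \<nu>: "0 < \<nu> {A..B}" "\<nu> {A..B} < top" using n by (auto simp: divide_simps)
  have w0: "(\<integral>\<^sup>+t\<in>{A..B}. ennreal (w0 t * t ^ (n - 1)) \<partial>lebesgue) = \<omega> {A..B}"
    unfolding nn_integral_completion \<omega>_def
  proof (rule nn_integral_cong_AE)
    show "AE t in lborel. ennreal (w0 t * t ^ (n - 1)) * indicator {A..B} t
        = ennreal (t ^ (n - 1)) * W t * indicator {A..B} t"
      using ae
    proof eventually_elim
      case (elim t)
      have "ennreal (w0 t * t ^ (n - 1)) = ennreal (t ^ (n - 1)) * ennreal (w0 t)" if "0 \<le> t"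
        using that by (simp add: ennreal_mult'' mult.commute)
      with elim A show ?case by (auto simp: indicator_def)
    qed
  qed
  have "is_interval {A..B} \<and> bounded {A..B} \<and> {A..B} \<subseteq> {0..} \<and> 0 < emeasure lebesgue {A..B}"
    using A by (auto simp: is_interval_cc)
  with adm have "(\<integral>\<^sup>+t\<in>{A..B}. ennreal (w0 t * t ^ (n - 1)) \<partial>lebesgue) / (\<integral>\<^sup>+t\<in>{A..B}. ennreal (t ^ (n - 1)) \<partial>lebesgue) \<le> C * e"
    unfolding A1_admissible_def e_def by blast
  then have "\<omega> {A..B} / \<nu> {A..B} \<le> C * e" unfolding w0[unfolded nn_integral_completion] nn_integral_completion \<nu>_def .
  then have "\<nu> {A..B} * (\<omega> {A..B} / \<nu> {A..B}) \<le> \<nu> {A..B} * (C * e)" by (rule mult_left_mono) simp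
  moreover have "\<nu> {A..B} * (\<omega> {A..B} / \<nu> {A..B}) = \<omega> {A..B}"
    using \<nu> by (simp add: ennreal_times_divide mult.commute[of "\<nu> _"] mult_divide_eq_ennreal)
  ultimately have avg: "\<omega> {A..B} \<le> \<nu> {A..B} * (C * e)" by simp
  have "e * \<nu> (E \<inter> {A..B}) \<le> \<omega> (E \<inter> {A..B})"
    unfolding e_def \<nu>_def \<omega>_def
    using ae A by (intro ess_inf_on_mult_le) (auto elim!: eventually_mono)
  then have "?k * (\<nu> {A..B} * C) * (e * \<nu> (E \<inter> {A..B})) \<le> ?k * (\<nu> {A..B} * C) * \<omega> (E \<inter> {A..B})"
    by (rule mult_left_mono) simp
  moreover have "?k * \<nu> (E \<inter> {A..B}) * \<omega> {A..B} \<le> ?k * \<nu> (E \<inter> {A..B}) * (\<nu> {A..B} * (C * e))"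
    using avg by (rule mult_left_mono) simp
  ultimately have "?k * \<omega> {A..B} * \<nu> (E \<inter> {A..B}) \<le> C * (?k * \<omega> (E \<inter> {A..B})) * \<nu> {A..B}"
    by (simp add: mult_ac)
  moreover have "emeasure (radial_measure n W) {A..B} = ?k * \<omega> {A..B}"
    "emeasure (radial_measure n W) (E \<inter> {A..B}) = ?k * \<omega> (E \<inter> {A..B})"
    using A by (auto intro!: M)
  ultimately show ?thesis unfolding \<nu>_def[symmetric] by (simp only:)
qed

lemma lorentz_weak_eq_0:
  assumes "\<And>l. 0 < l \<Longrightarrow> wmeasure w {x. ennreal l < g x} = 0"
  shows "lorentz_weak p w g = 0"
  using assms by (auto simp: lorentz_weak_def intro!: antisym SUP_least)

lemma emeasure_radial_measure_atMost_finite: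
  fixes w :: "'a::euclidean_space \<Rightarrow> real"
  assumes wt: "weight w" and w: "\<And>x. w x = w0 (norm x)"
    and W: "W \<in> borel_measurable borel"
    and ae: "AE t in lborel. 0 \<le> t \<longrightarrow> ennreal (w0 t) = W t"
  shows "emeasure (radial_measure DIM('a) W) {..R} < top"
proof -
  have "{x :: 'a. norm x \<in> {..R}} = cball 0 R" by auto
  then have "emeasure (radial_measure DIM('a) W) {..R} = wmeasure w (cball 0 R)"
    using wmeasure_radial[OF w W ae, of "{..R}" "{..R}"] by simp
  also have "\<dots> \<le> (\<integral>\<^sup>+x. ennreal (norm (indicator (cball 0 R) x *\<^sub>R w x)) \<partial>lebesgue)"
    unfolding wmeasure_def by (intro nn_integral_mono) (auto simp: indicator_def intro!: ennreal_leI)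
  also have "\<dots> < top"
    using wt by (auto simp: weight_def set_integrable_def integrable_iff_bounded)
  finally show ?thesis .
qed

lemma emeasure_radial_measure_pos:
  assumes n: "1 \<le> n" and W[measurable]: "W \<in> borel_measurable borel"
    and pos: "AE t in lborel. 0 \<le> t \<longrightarrow> 0 < W t" and A: "0 \<le> A" "A < B"
  shows "0 < emeasure (radial_measure n W) {A..B}"
proof (rule ccontr)
  assume "\<not> ?thesis"
  then have "(\<integral>\<^sup>+t\<in>{0..}. ennreal (t ^ (n - 1)) * (W t * indicator {A..B} t) \<partial>lborel) = 0"
    using radial_factor_pos[of n] n
    by (simp add: emeasure_radial_measure zero_less_iff_neq_zero)
  then have "AE t in lborel. ennreal (t ^ (n - 1)) * (W t * indicator {A..B} t) * indicator {0..} t = 0"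
    by (subst (asm) nn_integral_0_iff_AE) auto
  then have "AE t in lborel. t \<notin> {A..B}"
    using pos AE_lborel_singleton[of 0]
    by eventually_elim (use A in \<open>auto simp: indicator_def split: if_splits\<close>)
  then have "emeasure lborel {A..B} = 0"
    by (subst (asm) AE_iff_measurable[of "{A..B}"]) auto
  with A show False by simp
qed

section \<open>The weak type inequality\<close>

text \<open>
  A positive value at \<open>l\<close> would persist on the whole of \<open>(0, l]\<close>.
\<close>

lemma nn_integral_ennpowr_antimono_eq_0_imp:
  fixes D :: "real \<Rightarrow> ennreal"
  assumes D: "antimono D" and a: "0 < a"
    and int: "(\<integral>\<^sup>+m\<in>{0<..}. ennpowr (D m) a \<partial>lborel) = 0" and l: "0 < l"
  shows "D l = 0"
proof -
  have "ennreal l * ennpowr (D l) a = (\<integral>\<^sup>+m. ennpowr (D l) a * indicator {0<..l} m \<partial>lborel)"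
    using l by (subst nn_integral_cmult_indicator) (simp_all add: mult.commute)
  also have "\<dots> \<le> (\<integral>\<^sup>+m\<in>{0<..}. ennpowr (D m) a \<partial>lborel)"
    using antimonoD[OF D] a by (intro nn_integral_mono) (auto simp: indicator_def intro!: ennpowr_mono)
  finally have "ennpowr (D l) a \<le> 0" using l int by simp
  then show ?thesis using a by (subst (asm) ennpowr_le_iff) auto
qed

lemma AE_eq_0_of_null_superlevel_sets:
  assumes n: "1 \<le> n" and W[measurable]: "W \<in> borel_measurable borel"
    and pos: "AE t in lborel. 0 \<le> t \<longrightarrow> 0 < W t"
    and G[measurable]: "G \<in> borel_measurable borel"
    and null: "\<And>l. 0 < l \<Longrightarrow> emeasure (radial_measure n W) {t. ennreal l < G t} = 0"
  shows "AE t in lborel. 0 \<le> t \<longrightarrow> G t = 0"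
proof -
  have "AE t in lborel. 0 \<le> t \<longrightarrow> \<not> ennreal (1 / real (Suc k)) < G t" for k
  proof -
    have "(\<integral>\<^sup>+t\<in>{0..}. ennreal (t ^ (n - 1)) * (W t * indicator {t. ennreal (1 / real (Suc k)) < G t} t) \<partial>lborel) = 0"
      using null[of "1 / real (Suc k)"] radial_factor_pos[of n] n by (simp add: emeasure_radial_measure)
    then have "AE t in lborel. ennreal (t ^ (n - 1)) * (W t * indicator {t. ennreal (1 / real (Suc k)) < G t} t) * indicator {0..} t = 0"
      by (subst (asm) nn_integral_0_iff_AE) auto
    then show ?thesis
      using pos AE_lborel_singleton[of 0]
      by eventually_elim (auto simp: indicator_def split: if_splits)
  qed
  then have "AE t in lborel. \<forall>k. 0 \<le> t \<longrightarrow> \<not> ennreal (1 / real (Suc k)) < G t"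
    by (intro AE_all_countable[THEN iffD2] allI)
  then show ?thesis
  proof eventually_elim
    case (elim t)
    have False if "0 \<le> t" and G0: "G t \<noteq> 0"
    proof -
      from G0 have "0 < G t" by (simp add: zero_less_iff_neq_zero)
      then obtain c where c: "0 < c" "ennreal c < G t"
        by (metis dense ennreal_less_zero_iff less_top order.strict_trans ennreal_enn2real enn2real_nonneg)
      obtain k where "1 / real (Suc k) < c" using nat_approx_posE[OF c(1)] by auto
      then have "ennreal (1 / real (Suc k)) < ennreal c" by (simp add: ennreal_less_iff)
      with c(2) elim that(1) show False by (meson less_trans)
    qed
    then show ?case by blast
  qed
qed

text \<open>
  The case distinction takes care of the convention \<open>0 * \<infinity> = 0\<close>. If the weight vanishes, so does
  the left-hand side. Otherwise the weight is positive almost everywhere and its constant is at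
  least \<open>1\<close>. If the constant is infinite, the right-hand side is infinite unless \<open>f\<close> vanishes
  almost everywhere, and then \<open>\<K> f\<close> vanishes everywhere. The remaining case, a constant in
  \<open>[1, \<infinity>)\<close>, is the weak type inequality for the measure of radii.
\<close>

theorem radial_universal_maximal_weak_type:
  fixes f :: "'a::euclidean_space \<Rightarrow> 'b::real_normed_vector"
    and w :: "'a \<Rightarrow> real" and w0 :: "real \<Rightarrow> real"
  assumes n: "2 \<le> DIM('a)"
    and f: "f \<in> borel_measurable lebesgue" "radial f"
    and w: "\<And>x. w x = w0 (norm x)" and A1: "A1_weight w"
  shows "lorentz_weak (real DIM('a)) w (universal_maximal f)
    \<le> 2 * ennpowr (2 * radial_A1_const DIM('a) w0) (1 / real DIM('a))
       * lorentz_1 (real DIM('a)) w (\<lambda>x. ennreal (norm (f x)))"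
proof -
  let ?n = "DIM('a)"
  from A1 have wt: "weight w" by (simp add: A1_weight_def)
  obtain f0 where f0: "\<And>x. f x = f0 (norm x)" using f(2) by (auto simp: radial_def)
  have "(\<lambda>x. norm (f x)) \<in> borel_measurable lebesgue" using f(1) by measurable
  then obtain g where g[measurable]: "g \<in> borel_measurable borel"
    and g_ae: "AE t in lborel. 0 \<le> t \<longrightarrow> norm (f0 t) = g t"
    by (rule radial_borel_profile[where ?g0.0="\<lambda>t. norm (f0 t)"]) (simp add: f0)
  define G where "G t = ennreal (g t)" for t
  have G[measurable]: "G \<in> borel_measurable borel" unfolding G_def by measurable
  have G_ae: "AE t in lborel. 0 \<le> t \<longrightarrow> ennreal (norm (f0 t)) = G t"
    using g_ae by eventually_elim (auto simp: G_def)
  obtain w1 where w1[measurable]: "w1 \<in> borel_measurable borel"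
    and w1_ae: "AE t in lborel. 0 \<le> t \<longrightarrow> w0 t = w1 t"
    using radial_borel_profile[OF weight_measurable[OF wt] w] .
  define W where "W t = ennreal (w1 t)" for t
  have W[measurable]: "W \<in> borel_measurable borel" unfolding W_def by measurable
  have W_ae: "AE t in lborel. 0 \<le> t \<longrightarrow> ennreal (w0 t) = W t"
    using w1_ae by eventually_elim (auto simp: W_def)
  define M where "M = radial_measure ?n W"
  have sets: "sets M = sets borel" by (simp add: M_def)
  have wM: "wmeasure w {x. norm x \<in> V} = emeasure M V" if "V \<in> sets borel" for V
    unfolding M_def using that by (intro wmeasure_radial[OF w W W_ae]) auto
  have fin: "emeasure M {..R} < top" for R
    unfolding M_def by (rule emeasure_radial_measure_atMost_finite[OF wt w W W_ae])
  have level: "wmeasure w {x. ennreal l < ennreal (norm (f x))} = emeasure M {t. ennreal l < G t}" for l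
  proof -
    have "{x. ennreal l < ennreal (norm (f x))} = {x. norm x \<in> {t. ennreal l < ennreal (norm (f0 t))}}"
      by (simp add: f0)
    moreover have "wmeasure w {x. norm x \<in> {t. ennreal l < ennreal (norm (f0 t))}} = emeasure M {t. ennreal l < G t}"
      unfolding M_def
    proof (rule wmeasure_radial[OF w W W_ae])
      show "AE t in lborel. 0 \<le> t \<longrightarrow>
          (t \<in> {t. ennreal l < ennreal (norm (f0 t))} \<longleftrightarrow> t \<in> {t. ennreal l < G t})"
        using G_ae by eventually_elim auto
    qed measurable
    ultimately show ?thesis by (simp only:)
  qed
  define T where "T = (\<integral>\<^sup>+l\<in>{0<..}. ennpowr (emeasure M {t. ennreal l < G t}) (1 / ?n) \<partial>lborel)"
  have level_meas: "(\<lambda>l. emeasure M {t. ennreal l < G t}) \<in> borel_measurable borel"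
    using measurable_superlevel_Int[OF sets fin G, of UNIV] by simp
  have T: "T \<le> lorentz_1 ?n w (\<lambda>x. ennreal (norm (f x)))"
    using nn_integral_ennpowr_distribution_le_lorentz_1[of ?n w "\<lambda>x. ennreal (norm (f x))"] level_meas n
    unfolding level T_def by simp
  consider "AE x in lborel. w x = 0" | "AE x in lborel. 0 < w x"
    using A1_weight_zero_or_positive[OF A1] by blast
  then show ?thesis
  proof cases
    case 1
    have "wmeasure w S = 0" for S
    proof -
      have "wmeasure w S = (\<integral>\<^sup>+x. 0 \<partial>(lborel :: 'a measure))"
        unfolding wmeasure_def nn_integral_completion
        by (rule nn_integral_cong_AE) (use 1 in \<open>auto elim: eventually_mono\<close>)
      then show ?thesis by simp
    qed
    then show ?thesis by (simp add: lorentz_weak_eq_0)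
  next
    case 2
    have "AE x in (lborel :: 'a measure). 0 < W (norm x)"
      using 2 AE_norm_of_profile[OF W_ae] by eventually_elim (metis ennreal_less_zero_iff w)
    then have W_pos: "AE t in lborel. 0 \<le> t \<longrightarrow> 0 < W t"
      by (subst (asm) AE_radial_iff) auto
    have pos: "0 < emeasure M {A..B}" if "0 \<le> A" "A < B" for A B
      unfolding M_def using n by (intro emeasure_radial_measure_pos[OF _ W W_pos that]) simp
    have A1_M: "emeasure M {A..B} * (\<integral>\<^sup>+t\<in>E \<inter> {A..B}. ennreal (t ^ (?n - 1)) \<partial>lborel)
      \<le> C * emeasure M (E \<inter> {A..B}) * (\<integral>\<^sup>+t\<in>{A..B}. ennreal (t ^ (?n - 1)) \<partial>lborel)"
      if "A1_admissible ?n w0 C" "0 \<le> A" "A < B" "E \<in> sets borel" for A B E C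
      unfolding M_def using n by (intro A1_admissible_radial_measure[OF _ that(1) W W_ae that(2-)]) simp
    have ge1: "1 \<le> C" if "A1_admissible ?n w0 C" for C
    proof -
      \<comment> \<open>The unit interval compared with itself.\<close>
      define \<nu> where "\<nu> = (\<integral>\<^sup>+t\<in>{0..1}. ennreal (t ^ (?n - 1)) \<partial>lborel)"
      have "\<nu> = ennreal (1 ^ ?n / ?n - 0 ^ ?n / ?n)"
        unfolding \<nu>_def
        by (intro nn_integral_FTC_Icc[where F="\<lambda>t. t ^ ?n / ?n"]) (auto intro!: derivative_eq_intros)
      then have \<nu>: "0 < \<nu>" "\<nu> < top" by (simp_all add: zero_power)
      have M01: "0 < emeasure M {0..1}" "emeasure M {0..1} < top"
        using pos[of 0 1] by (auto intro: order_le_less_trans[OF emeasure_mono fin[of 1]] simp: sets)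
      have "(emeasure M {0..1} * \<nu>) * 1 \<le> (emeasure M {0..1} * \<nu>) * C"
        using A1_M[OF that, of 0 1 UNIV] unfolding Int_UNIV_left \<nu>_def[symmetric] by (simp add: mult_ac)
      moreover have "emeasure M {0..1} * \<nu> \<noteq> 0" "emeasure M {0..1} * \<nu> \<noteq> top"
        using M01 \<nu> by (auto simp: ennreal_mult_eq_top_iff)
      ultimately show ?thesis using ennreal_mult_le_mult_iff by blast
    qed
    have c_ge1: "1 \<le> radial_A1_const ?n w0"
      unfolding radial_A1_const_eq_Inf using ge1 by (intro Inf_greatest) auto
    show ?thesis
    proof (cases "radial_A1_const ?n w0 = top")
      case True
      show ?thesis
      proof (cases "T = 0")
        case False
        with T have "lorentz_1 ?n w (\<lambda>x. ennreal (norm (f x))) \<noteq> 0" by auto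
        then show ?thesis using True by (simp add: ennreal_mult_top ennreal_top_mult ennpowr_def)
      next
        case T0: True
        have "emeasure M {t. ennreal l < G t} = 0" if "0 < l" for l
        proof (rule nn_integral_ennpowr_antimono_eq_0_imp[OF _ _ _ that])
          show "antimono (\<lambda>l. emeasure M {t. ennreal l < G t})"
            by (intro antimonoI emeasure_mono) (auto simp: sets intro: le_less_trans[OF ennreal_leI])
        qed (use T0 n in \<open>simp_all add: T_def\<close>)
        then have "AE t in lborel. 0 \<le> t \<longrightarrow> G t = 0"
          unfolding M_def using n by (intro AE_eq_0_of_null_superlevel_sets[of ?n, OF _ W W_pos G]) auto
        then have "AE t in lborel. 0 \<le> t \<longrightarrow> ennreal (norm (f0 t)) = 0"
          using G_ae by eventually_elim auto
        from universal_maximal_profile[of f f0 "\<lambda>_. 0", OF f0 this]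
        have "universal_maximal f x \<le> 0" for x
          by (simp only:) (intro SUP_least, auto)
        then have "lorentz_weak ?n w (universal_maximal f) = 0"
          by (intro lorentz_weak_eq_0) (auto simp: wmeasure_def not_less[symmetric])
        then show ?thesis by simp
      qed
    next
      case False
      \<comment> \<open>The infimum \<open>C\<close> is itself admissible, so the weak type bound can be applied with it directly.\<close>
      then obtain C where C: "radial_A1_const ?n w0 = ennreal C" "1 \<le> C"
        using c_ge1 by (cases "radial_A1_const ?n w0") auto
      have adm: "A1_admissible ?n w0 (ennreal C)"
        using A1_admissible_radial_A1_const[of ?n w0] C by (simp add: less_top[symmetric] False)
      have "lorentz_weak ?n w (universal_maximal f) \<le> ennreal (2 * C powr (1 / ?n) * 2 powr (1 / ?n)) * T"
        unfolding lorentz_weak_def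
      proof (rule SUP_least)
        fix l :: real assume "l \<in> {0<..}"
        then have l: "0 < l" by simp
        have C0: "0 < C" using C by simp
        obtain V where V: "open V" "{x. universal_maximal f x > ennreal l} \<subseteq> {x. norm x \<in> V}"
          "ennreal l * ennpowr (emeasure M V) (1 / ?n) \<le> ennreal (2 * C powr (1 / ?n) * 2 powr (1 / ?n)) * T"
          unfolding T_def
          by (rule radial_weak_type[OF f0 G G_ae sets n C0 fin pos A1_M[OF adm] l])
        have "wmeasure w {x. universal_maximal f x > ennreal l} \<le> wmeasure w {x. norm x \<in> V}"
          unfolding wmeasure_def using V(2) by (intro nn_integral_mono) (auto simp: indicator_def)
        also have "\<dots> = emeasure M V" using V(1) by (intro wM) auto
        finally have "ennreal l * ennpowr (wmeasure w {x. universal_maximal f x > ennreal l}) (1 / ?n)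
            \<le> ennreal l * ennpowr (emeasure M V) (1 / ?n)"
          by (intro mult_left_mono ennpowr_mono) auto
        with V(3) show "ennreal l * ennpowr (wmeasure w {x. ennreal l < universal_maximal f x}) (1 / ?n)
            \<le> ennreal (2 * C powr (1 / ?n) * 2 powr (1 / ?n)) * T"
          by (rule order_trans[rotated])
      qed
      also have "ennreal (2 * C powr (1 / ?n) * 2 powr (1 / ?n))
          = 2 * ennpowr (2 * radial_A1_const ?n w0) (1 / ?n)"
      proof -
        have "2 * radial_A1_const ?n w0 = ennreal (2 * C)" using C by (simp add: ennreal_mult)
        then have "ennpowr (2 * radial_A1_const ?n w0) (1 / ?n) = ennreal ((2 * C) powr (1 / ?n))"
          using C by (simp only: ennpowr_ennreal)
        then show ?thesis using C by (simp add: powr_mult ennreal_mult mult_ac)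
      qed
      also have "2 * ennpowr (2 * radial_A1_const ?n w0) (1 / ?n) * T
          \<le> 2 * ennpowr (2 * radial_A1_const ?n w0) (1 / ?n) * lorentz_1 ?n w (\<lambda>x. ennreal (norm (f x)))"
        by (intro mult_left_mono T) auto
      finally show ?thesis .
    qed
  qed
qed

theorem theorem4p2:
  fixes f :: "real ^ 'n \<Rightarrow> 'b::real_normed_vector"
    and w :: "real ^ 'n \<Rightarrow> real"
    and w0 :: "real \<Rightarrow> real"
  assumes "CARD('n) \<ge> 2"
    and "f \<in> borel_measurable lebesgue"
    and "radial f"
    and "\<And>x. w x = w0 (norm x)"
    and "A1_weight w"
  shows "lorentz_weak (real CARD('n)) w (universal_maximal f)
    \<le> ennreal (2 * real CARD('n) / (real CARD('n) - 1))
       * ennpowr (2 * radial_A1_const CARD('n) w0) (1 / real CARD('n))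
       * lorentz_1 (real CARD('n)) w (\<lambda>x. ennreal (norm (f x)))"
proof -
  have dim: "DIM(real ^ 'n) = CARD('n)" by simp
  have "lorentz_weak (real CARD('n)) w (universal_maximal f)
    \<le> 2 * ennpowr (2 * radial_A1_const CARD('n) w0) (1 / real CARD('n))
       * lorentz_1 (real CARD('n)) w (\<lambda>x. ennreal (norm (f x)))"
    using radial_universal_maximal_weak_type[of f w w0] assms unfolding dim by simp
  also have "\<dots> \<le> ennreal (2 * real CARD('n) / (real CARD('n) - 1))
       * ennpowr (2 * radial_A1_const CARD('n) w0) (1 / real CARD('n))
       * lorentz_1 (real CARD('n)) w (\<lambda>x. ennreal (norm (f x)))"
  proof (intro mult_right_mono)
    have "ennreal 2 \<le> ennreal (2 * real CARD('n) / (real CARD('n) - 1))"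
      using assms(1) by (intro ennreal_leI) (simp add: field_simps)
    then show "2 \<le> ennreal (2 * real CARD('n) / (real CARD('n) - 1))" by simp
  qed auto
  finally show ?thesis .
qed

end
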